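(* Let $\varphi:\mathbb{D}\to\mathbb{D}$ be holomorphic, $\varphi\notin\mathrm{Aut}(\mathbb{D})$, and suppose there is $\alpha\in\mathbb{D}$ with $\varphi(\alpha)=\alpha$ and $0<|\varphi'(\alpha)|<1$. Put $\lambda_n=\varphi'(\alpha)^n$ for $n\in\mathbb{N}_0$. Then the composition operator $C_\varphi f=f\circ\varphi$ on $\mathrm{Hol}(\mathbb{D})$ is a Riesz operator. Moreover, for each $n\in\mathbb{N}_0$, the spectral projection associated with $\lambda_n$ is $P_n$.
   Context: $\mathbb{D}$ is the open unit disc, $\mathrm{Hol}(\mathbb{D})$ the Fréchet space of holomorphic functions on $\mathbb{D}$ (uniform convergence on compact sets), $\mathrm{Aut}(\mathbb{D})$ the group of holomorphic automorphisms of $\mathbb{D}$, $\mathbb{N}_0=\{0,1,2,\dots\}$, $\mathbb{N}=\{1,2,\dots\}$. Koenigs' eigenfunction $\kappa$ of $\varphi$ is the unique $\kappa\in\mathrm{Hol}(\mathbb{D})$ with $\kappa\circ\varphi=\varphi'(\alpha)\kappa$ and $\kappa'(\alpha)=1$ (it exists and is unique by Koenigs' theorem); $\kappa^0=1$. The operators $P_n$ on $\mathrm{Hol}(\mathbb{D})$ are defined inductively by $P_0f=f(\alpha)\cdot 1$ and, for $n\in\mathbb{N}$, $P_nf=\frac1{n!}g^{(n)}(\alpha)\,\kappa^n$ where $g=f-\sum_{k=0}^{n-1}P_kf$. Let $Y$ be a Fréchet space and $S:Y\to Y$ linear and continuous, with spectrum $\sigma(S)=\{\lambda\in\mathbb{C}:\lambda\,\mathrm{Id}-S\text{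 not bijective}\}$. A number $\lambda\in\sigma(S)$ is a Riesz point if $\lambda$ is isolated in $\sigma(S)$ and there is a decomposition $Y=Y_1\oplus Y_2$ into closed $S$-invariant subspaces such that $\dim Y_1<\infty$, $\sigma(S_{|Y_1})=\{\lambda\}$ and $(\lambda\,\mathrm{Id}-S)_{|Y_2}$ is invertible (on $Y_2$). This decomposition is unique, and the projection of $Y$ onto $Y_1$ along $Y_2$ is called the spectral projection associated with the Riesz point $\lambda$. The essential spectrum is $\sigma_e(S)=\{\lambda\in\sigma(S):\lambda\text{ is not a Riesz point}\}$, the essential spectral radius is $r_e(S)=\sup\{|\lambda|:\lambda\in\sigma_e(S)\}$, and $S$ is a Riesz operator if $r_e(S)=0$. *)

theory Defs
  imports "HOL-Complex_Analysis.Complex_Analysis"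
begin

section \<open>Complex Frechet spaces\<close>

class complex_vector = ab_group_add +
  fixes scaleC :: "complex \<Rightarrow> 'a \<Rightarrow> 'a"  (infixr \<open>*\<^sub>C\<close> 75)
  assumes scaleC_add_right: "a *\<^sub>C (x + y) = a *\<^sub>C x + a *\<^sub>C y"
    and scaleC_add_left: "(a + b) *\<^sub>C x = a *\<^sub>C x + b *\<^sub>C x"
    and scaleC_scaleC: "a *\<^sub>C b *\<^sub>C x = (a * b) *\<^sub>C x"
    and scaleC_one: "1 *\<^sub>C x = x"
begin

definition seminorm :: "('a \<Rightarrow> real) \<Rightarrow> bool" where
  "seminorm p \<longleftrightarrow> (\<forall>x y. p (x + y) \<le> p x + p y) \<and> (\<forall>c x. p (c *\<^sub>C x) = norm c * p x)"

end

global_interpretation complex_vector: vector_space "scaleC :: complex \<Rightarrow> 'a \<Rightarrow> 'a::complex_vector"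
  by unfold_locales (simp_all add: scaleC_add_right scaleC_add_left scaleC_scaleC scaleC_one)

text \<open>
  The topology is generated by a separating sequence of seminorms for which the space is
  (sequentially) complete.
\<close>

class frechet_space = complex_vector + topological_space +
  assumes frechet: "\<exists>p :: nat \<Rightarrow> 'a \<Rightarrow> real.
      (\<forall>k. seminorm (p k)) \<and>
      (\<forall>x. (\<forall>k. p k x = 0) \<longrightarrow> x = 0) \<and>
      (\<forall>U. open U \<longleftrightarrow> (\<forall>x\<in>U. \<exists>n. \<exists>\<epsilon>>0. \<forall>y. (\<forall>k\<le>n. p k (y - x) < \<epsilon>) \<longrightarrow> y \<in> U)) \<and>
      (\<forall>X. (\<forall>k. \<forall>\<epsilon>>0. \<exists>M. \<forall>i\<ge>M. \<forall>j\<ge>M. p k (X i - X j) < \<epsilon>) \<longrightarrow>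
           (\<exists>x. \<forall>k. (\<lambda>i. p k (X i - x)) \<longlonglongrightarrow> 0))"


section \<open>Riesz points and Riesz operators\<close>

text \<open>
  The spectrum of the restriction of \<open>S\<close> to an \<open>S\<close>-invariant subspace \<open>Y\<close>; the spectrum of \<open>S\<close>
  itself is the case \<open>Y = UNIV\<close>.
\<close>

definition spectrum_on :: "'a::complex_vector set \<Rightarrow> ('a \<Rightarrow> 'a) \<Rightarrow> complex set" where
  "spectrum_on Y S = {\<mu>. \<not> bij_betw (\<lambda>y. \<mu> *\<^sub>C y - S y) Y Y}"

abbreviation spectrum :: "('a::complex_vector \<Rightarrow> 'a) \<Rightarrow> complex set" where
  "spectrum S \<equiv> spectrum_on UNIV S"

definition riesz_decomposition ::
    "('a::frechet_space \<Rightarrow> 'a) \<Rightarrow> complex \<Rightarrow> 'a set \<Rightarrow> 'a set \<Rightarrow> bool" where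
  "riesz_decomposition S \<mu> Y1 Y2 \<longleftrightarrow>
     complex_vector.subspace Y1 \<and> closed Y1 \<and> S ` Y1 \<subseteq> Y1 \<and>
     complex_vector.subspace Y2 \<and> closed Y2 \<and> S ` Y2 \<subseteq> Y2 \<and>
     Y1 \<inter> Y2 = {0} \<and> (\<forall>y. \<exists>y1\<in>Y1. \<exists>y2\<in>Y2. y = y1 + y2) \<and>
     (\<exists>B. finite B \<and> complex_vector.span B = Y1) \<and>
     spectrum_on Y1 S = {\<mu>} \<and>
     bij_betw (\<lambda>y. \<mu> *\<^sub>C y - S y) Y2 Y2"

definition riesz_point :: "('a::frechet_space \<Rightarrow> 'a) \<Rightarrow> complex \<Rightarrow> bool" where
  "riesz_point S \<mu> \<longleftrightarrow>
     \<mu> isolated_in spectrum S \<and> (\<exists>Y1 Y2. riesz_decomposition S \<mu> Y1 Y2)"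

text \<open>\<open>P\<close> is the projection onto \<open>Y1\<close> along \<open>Y2\<close> for the (unique) decomposition at \<open>\<mu>\<close>.\<close>

definition is_spectral_projection ::
    "('a::frechet_space \<Rightarrow> 'a) \<Rightarrow> complex \<Rightarrow> ('a \<Rightarrow> 'a) \<Rightarrow> bool" where
  "is_spectral_projection S \<mu> P \<longleftrightarrow>
     riesz_point S \<mu> \<and>
     (\<exists>Y1 Y2. riesz_decomposition S \<mu> Y1 Y2 \<and> (\<forall>y1\<in>Y1. \<forall>y2\<in>Y2. P (y1 + y2) = y1))"

definition essential_spectrum :: "('a::frechet_space \<Rightarrow> 'a) \<Rightarrow> complex set" where
  "essential_spectrum S = {\<mu> \<in> spectrum S. \<not> riesz_point S \<mu>}"

text \<open>The supremum lives in \<open>[0, \<infinity>]\<close>, as the spectrum may be unbounded or empty.\<close>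

definition essential_spectral_radius :: "('a::frechet_space \<Rightarrow> 'a) \<Rightarrow> ennreal" where
  "essential_spectral_radius S = (SUP \<mu>\<in>essential_spectrum S. ennreal (norm \<mu>))"

definition riesz_operator :: "('a::frechet_space \<Rightarrow> 'a) \<Rightarrow> bool" where
  "riesz_operator S \<longleftrightarrow>
     Vector_Spaces.linear scaleC scaleC S \<and> continuous_on UNIV S \<and>
     essential_spectral_radius S = 0"


section \<open>Holomorphic functions on the unit disc\<close>

abbreviation unit_disc :: "complex set" where
  "unit_disc \<equiv> ball 0 1"

definition disc_automorphisms :: "(complex \<Rightarrow> complex) set" where
  "disc_automorphisms = {\<phi>. \<phi> holomorphic_on unit_disc \<and> bij_betw \<phi> unit_disc unit_disc \<and>
     inv_into unit_disc \<phi> holomorphic_on unit_disc}"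

text \<open>
  Functions are total in HOL; setting them to \<open>0\<close> off the disc makes equality of elements of
  \<open>hol_disc\<close> coincide with equality on the disc.
\<close>

typedef hol_disc = "{f :: complex \<Rightarrow> complex. f holomorphic_on unit_disc \<and> (\<forall>z. z \<notin> unit_disc \<longrightarrow> f z = 0)}"
  morphisms hol_fun Abs_hol_disc
  by (rule exI[of _ "\<lambda>_. 0"]) auto

text \<open>\<open>hol_of f\<close> is only meaningful if \<open>f\<close> is holomorphic on the disc.\<close>

definition hol_of :: "(complex \<Rightarrow> complex) \<Rightarrow> hol_disc" where
  "hol_of f = Abs_hol_disc (\<lambda>z. if z \<in> unit_disc then f z else 0)"

lemma hol_fun_holomorphic: "hol_fun f holomorphic_on unit_disc"
  using hol_fun[of f] by auto

lemma hol_fun_outside: "z \<notin> unit_disc \<Longrightarrow> hol_fun f z = 0"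
  using hol_fun[of f] by auto

lemma hol_fun_hol_of:
  assumes "f holomorphic_on unit_disc"
  shows "hol_fun (hol_of f) = (\<lambda>z. if z \<in> unit_disc then f z else 0)"
proof -
  have "(\<lambda>z. if z \<in> unit_disc then f z else 0) holomorphic_on unit_disc"
    using assms by (subst holomorphic_cong[OF refl, of _ _ f]) auto
  then show ?thesis
    unfolding hol_of_def by (intro Abs_hol_disc_inverse) auto
qed

lemma hol_disc_eqI: "(\<And>z. z \<in> unit_disc \<Longrightarrow> hol_fun f z = hol_fun g z) \<Longrightarrow> f = g"
  by (metis (no_types) hol_fun_inject hol_fun_outside ext)

instantiation hol_disc :: comm_ring_1
begin

definition "0 = hol_of (\<lambda>z. 0)"
definition "1 = hol_of (\<lambda>z. 1)"
definition "f + g = hol_of (\<lambda>z. hol_fun f z + hol_fun g z)"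
definition "f - g = hol_of (\<lambda>z. hol_fun f z - hol_fun g z)"
definition "- f = hol_of (\<lambda>z. - hol_fun f z)"
definition "f * g = hol_of (\<lambda>z. hol_fun f z * hol_fun g z)"

lemma hol_fun_ops:
  "hol_fun 0 z = 0"
  "hol_fun 1 z = (if z \<in> unit_disc then 1 else 0)"
  "hol_fun (f + g) z = hol_fun f z + hol_fun g z"
  "hol_fun (f - g) z = hol_fun f z - hol_fun g z"
  "hol_fun (- f) z = - hol_fun f z"
  "hol_fun (f * g) z = hol_fun f z * hol_fun g z"
  unfolding zero_hol_disc_def one_hol_disc_def plus_hol_disc_def minus_hol_disc_def
    uminus_hol_disc_def times_hol_disc_def
  by (subst hol_fun_hol_of;
      auto intro!: holomorphic_intros hol_fun_holomorphic simp: hol_fun_outside)+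

instance
proof
  show "(0 :: hol_disc) \<noteq> 1"
  proof
    assume "(0 :: hol_disc) = 1"
    then have "hol_fun 0 0 = hol_fun 1 0" by simp
    then show False by (simp only: hol_fun_ops) simp
  qed
qed (rule hol_disc_eqI, simp add: hol_fun_ops algebra_simps)+

end

lemma hol_fun_power: "z \<in> unit_disc \<Longrightarrow> hol_fun (f ^ n) z = hol_fun f z ^ n"
  by (induction n) (auto simp: hol_fun_ops)

instantiation hol_disc :: complex_vector
begin

definition "c *\<^sub>C f = hol_of (\<lambda>z. c * hol_fun f z)"

lemma hol_fun_scaleC: "hol_fun (c *\<^sub>C f) z = c * hol_fun f z"
  unfolding scaleC_hol_disc_def
  by (subst hol_fun_hol_of; auto intro!: holomorphic_intros hol_fun_holomorphic simp: hol_fun_outside)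

instance
  by standard (rule hol_disc_eqI, simp add: hol_fun_ops hol_fun_scaleC algebra_simps)+

end

text \<open>The topology of uniform convergence on compact subsets of the disc.\<close>

instantiation hol_disc :: topological_space
begin

definition "open (U :: hol_disc set) \<longleftrightarrow>
  (\<forall>f\<in>U. \<exists>K \<epsilon>. compact K \<and> K \<subseteq> unit_disc \<and> \<epsilon> > 0 \<and>
     (\<forall>g. (\<forall>z\<in>K. norm (hol_fun g z - hol_fun f z) < \<epsilon>) \<longrightarrow> g \<in> U))"

instance
proof
  show "open (UNIV :: hol_disc set)"
    unfolding open_hol_disc_def by (intro ballI exI[of _ "{}"] exI[of _ 1]) auto
next
  fix S T :: "hol_disc set"
  assume S: "open S" and T: "open T"
  show "open (S \<inter> T)"
    unfolding open_hol_disc_def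
  proof
    fix f assume "f \<in> S \<inter> T"
    then obtain K e K' e' where "compact K" "K \<subseteq> unit_disc" "e > 0"
        "\<forall>g. (\<forall>z\<in>K. norm (hol_fun g z - hol_fun f z) < e) \<longrightarrow> g \<in> S"
        "compact K'" "K' \<subseteq> unit_disc" "e' > 0"
        "\<forall>g. (\<forall>z\<in>K'. norm (hol_fun g z - hol_fun f z) < e') \<longrightarrow> g \<in> T"
      using S T unfolding open_hol_disc_def by (metis IntE)
    then show "\<exists>K \<epsilon>. compact K \<and> K \<subseteq> unit_disc \<and> \<epsilon> > 0 \<and>
        (\<forall>g. (\<forall>z\<in>K. norm (hol_fun g z - hol_fun f z) < \<epsilon>) \<longrightarrow> g \<in> S \<inter> T)"
      by (intro exI[of _ "K \<union> K'"] exI[of _ "min e e'"]) (auto intro: compact_Un)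
  qed
next
  fix A :: "hol_disc set set"
  assume A: "\<forall>S\<in>A. open S"
  show "open (\<Union>A)"
    unfolding open_hol_disc_def
  proof
    fix f assume "f \<in> \<Union>A"
    then obtain S where S: "S \<in> A" "f \<in> S" by auto
    then obtain K e where "compact K" "K \<subseteq> unit_disc" "e > 0"
        "\<forall>g. (\<forall>z\<in>K. norm (hol_fun g z - hol_fun f z) < e) \<longrightarrow> g \<in> S"
      using A unfolding open_hol_disc_def by metis
    then show "\<exists>K \<epsilon>. compact K \<and> K \<subseteq> unit_disc \<and> \<epsilon> > 0 \<and>
        (\<forall>g. (\<forall>z\<in>K. norm (hol_fun g z - hol_fun f z) < \<epsilon>) \<longrightarrow> g \<in> \<Union>A)"
      using S by (intro exI[of _ K] exI[of _ e]) auto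
  qed
qed

end

definition disc_radius :: "nat \<Rightarrow> real" where
  "disc_radius k = 1 - 1 / real (k + 2)"

definition disc_seminorm :: "nat \<Rightarrow> hol_disc \<Rightarrow> real" where
  "disc_seminorm k f = (SUP z\<in>cball 0 (disc_radius k). norm (hol_fun f z))"

lemma disc_radius: "0 < disc_radius k" "disc_radius k < 1"
  by (auto simp: disc_radius_def field_simps)

lemma disc_radius_subset: "cball 0 (disc_radius k) \<subseteq> unit_disc"
  using disc_radius(2)[of k] by auto

lemma disc_radius_mono: "j \<le> k \<Longrightarrow> disc_radius j \<le> disc_radius k"
  unfolding disc_radius_def by (simp add: frac_le)

lemma disc_radius_exhausts:
  assumes "r < 1"
  shows "\<exists>k. r \<le> disc_radius k"
proof -
  obtain k :: nat where "1 / (1 - r) < real k" using reals_Archimedean2 by blast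
  then have "1 / (1 - r) \<le> real (k + 2)" by simp
  then have "1 / real (k + 2) \<le> 1 - r" using assms by (simp add: field_simps)
  then show ?thesis by (auto simp: disc_radius_def intro: exI[of _ k])
qed

lemma compact_disc_exhausted:
  assumes "compact K" "K \<subseteq> unit_disc"
  shows "\<exists>k. K \<subseteq> cball 0 (disc_radius k)"
proof (cases "K = {}")
  case False
  then obtain w where w: "w \<in> K" "\<forall>z\<in>K. norm z \<le> norm w"
    using continuous_attains_sup[OF assms(1), of norm] continuous_on_norm_id by blast
  then have "norm w < 1" using assms(2) by auto
  then show ?thesis using disc_radius_exhausts w(2) by (metis mem_cball_0 order_trans subsetI)
qed auto

lemma disc_seminorm_attained:
  "\<exists>w\<in>cball 0 (disc_radius k). disc_seminorm k f = norm (hol_fun f w) \<and>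
     (\<forall>z\<in>cball 0 (disc_radius k). norm (hol_fun f z) \<le> norm (hol_fun f w))"
proof -
  have "continuous_on (cball 0 (disc_radius k)) (\<lambda>z. norm (hol_fun f z))"
    using hol_fun_holomorphic disc_radius_subset
    by (intro continuous_on_norm) (metis continuous_on_subset holomorphic_on_imp_continuous_on)
  then obtain w where w: "w \<in> cball 0 (disc_radius k)"
      "\<forall>z\<in>cball 0 (disc_radius k). norm (hol_fun f z) \<le> norm (hol_fun f w)"
    using continuous_attains_sup[of "cball 0 (disc_radius k)" "\<lambda>z. norm (hol_fun f z)"]
      disc_radius(1)[of k] by auto
  then have "disc_seminorm k f = norm (hol_fun f w)"
    unfolding disc_seminorm_def by (intro cSup_eq_maximum) auto
  with w show ?thesis by blast
qed

lemma disc_seminorm_less_iff: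
  "disc_seminorm k f < e \<longleftrightarrow> (\<forall>z\<in>cball 0 (disc_radius k). norm (hol_fun f z) < e)"
  using disc_seminorm_attained[of k f] by force

lemma disc_seminorm_le_iff:
  "disc_seminorm k f \<le> e \<longleftrightarrow> (\<forall>z\<in>cball 0 (disc_radius k). norm (hol_fun f z) \<le> e)"
  using disc_seminorm_attained[of k f] by force

lemma disc_seminorm_ge:
  "z \<in> cball 0 (disc_radius k) \<Longrightarrow> norm (hol_fun f z) \<le> disc_seminorm k f"
  using disc_seminorm_le_iff by blast

lemma disc_seminorm_nonneg: "disc_seminorm k f \<ge> 0"
  using disc_seminorm_attained[of k f] by force

lemma open_hol_disc_iff:
  "open U \<longleftrightarrow> (\<forall>f\<in>U. \<exists>n. \<exists>\<epsilon>>0. \<forall>g. (\<forall>k\<le>n. disc_seminorm k (g - f) < \<epsilon>) \<longrightarrow> g \<in> U)"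
proof
  assume U: "open U"
  show "\<forall>f\<in>U. \<exists>n. \<exists>\<epsilon>>0. \<forall>g. (\<forall>k\<le>n. disc_seminorm k (g - f) < \<epsilon>) \<longrightarrow> g \<in> U"
  proof
    fix f assume "f \<in> U"
    then obtain K e where K: "compact K" "K \<subseteq> unit_disc" "e > 0"
        "\<forall>g. (\<forall>z\<in>K. norm (hol_fun g z - hol_fun f z) < e) \<longrightarrow> g \<in> U"
      using U unfolding open_hol_disc_def by metis
    obtain n where "K \<subseteq> cball 0 (disc_radius n)"
      using compact_disc_exhausted K by blast
    then show "\<exists>n. \<exists>\<epsilon>>0. \<forall>g. (\<forall>k\<le>n. disc_seminorm k (g - f) < \<epsilon>) \<longrightarrow> g \<in> U"
      using K(3,4)
      by (intro exI[of _ n] exI[of _ e]) (fastforce simp: disc_seminorm_less_iff hol_fun_ops)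
  qed
next
  assume U: "\<forall>f\<in>U. \<exists>n. \<exists>\<epsilon>>0. \<forall>g. (\<forall>k\<le>n. disc_seminorm k (g - f) < \<epsilon>) \<longrightarrow> g \<in> U"
  show "open U"
    unfolding open_hol_disc_def
  proof
    fix f assume "f \<in> U"
    then obtain n e where n: "e > 0" "\<forall>g. (\<forall>k\<le>n. disc_seminorm k (g - f) < e) \<longrightarrow> g \<in> U"
      using U by blast
    have "g \<in> U" if "\<forall>z\<in>cball 0 (disc_radius n). norm (hol_fun g z - hol_fun f z) < e" for g
      using n(2) that by (force simp: disc_seminorm_less_iff hol_fun_ops dest: disc_radius_mono)
    then show "\<exists>K \<epsilon>. compact K \<and> K \<subseteq> unit_disc \<and> \<epsilon> > 0 \<and>
        (\<forall>g. (\<forall>z\<in>K. norm (hol_fun g z - hol_fun f z) < \<epsilon>) \<longrightarrow> g \<in> U)"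
      using n(1) disc_radius_subset[of n]
      by (intro exI[of _ "cball 0 (disc_radius n)"] exI[of _ e]) auto
  qed
qed

lemma hol_disc_complete:
  assumes cau: "\<forall>k. \<forall>\<epsilon>>0. \<exists>M. \<forall>i\<ge>M. \<forall>j\<ge>M. disc_seminorm k (X i - X j) < \<epsilon>"
  shows "\<exists>f. \<forall>k. (\<lambda>i. disc_seminorm k (X i - f)) \<longlonglongrightarrow> 0"
proof -
  define g where "g = (\<lambda>z. lim (\<lambda>i. hol_fun (X i) z))"
  have "uniformly_Cauchy_on (cball 0 (disc_radius k)) (\<lambda>i. hol_fun (X i))" for k
    using cau unfolding uniformly_Cauchy_on_def dist_norm disc_seminorm_less_iff hol_fun_ops by meson
  then have ulim: "uniform_limit (cball 0 (disc_radius k)) (\<lambda>i. hol_fun (X i)) g sequentially" for k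
    unfolding g_def using Cauchy_uniformly_convergent uniformly_convergent_uniform_limit_iff by blast
  have "g holomorphic_on unit_disc"
  proof (rule holomorphic_uniform_sequence[where f = "\<lambda>i. hol_fun (X i)"])
    fix x :: complex assume x: "x \<in> unit_disc"
    obtain d where d: "d > 0" "cball x d \<subseteq> unit_disc"
      using x open_contains_cball[of unit_disc] open_ball by blast
    obtain k where "cball x d \<subseteq> cball 0 (disc_radius k)"
      using compact_disc_exhausted[of "cball x d"] d by auto
    then show "\<exists>d. 0 < d \<and> cball x d \<subseteq> unit_disc \<and>
        uniform_limit (cball x d) (\<lambda>i. hol_fun (X i)) g sequentially"
      using d uniform_limit_on_subset[OF ulim] by blast
  qed (auto intro: hol_fun_holomorphic)
  then have g: "hol_fun (hol_of g) z = g z" if "z \<in> unit_disc" for z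
    using that by (simp add: hol_fun_hol_of)
  show ?thesis
  proof (intro exI allI)
    fix k
    show "(\<lambda>i. disc_seminorm k (X i - hol_of g)) \<longlonglongrightarrow> 0"
    proof (rule LIMSEQ_I)
      fix e :: real assume "e > 0"
      then obtain M where M: "\<forall>i\<ge>M. \<forall>z\<in>cball 0 (disc_radius k). dist (hol_fun (X i) z) (g z) < e"
        using ulim[of k] unfolding uniform_limit_iff eventually_sequentially by blast
      have "disc_seminorm k (X i - hol_of g) < e" if "i \<ge> M" for i
        unfolding disc_seminorm_less_iff
      proof
        fix z :: complex assume z: "z \<in> cball 0 (disc_radius k)"
        then have "z \<in> unit_disc" using disc_radius_subset by blast
        then show "norm (hol_fun (X i - hol_of g) z) < e"
          using M that z by (simp add: hol_fun_ops g dist_norm)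
      qed
      then show "\<exists>M. \<forall>i\<ge>M. norm (disc_seminorm k (X i - hol_of g) - 0) < e"
        using disc_seminorm_nonneg by auto
    qed
  qed
qed

instance hol_disc :: frechet_space
proof
  have tri: "disc_seminorm k (f + g) \<le> disc_seminorm k f + disc_seminorm k g" for k f g
    unfolding disc_seminorm_le_iff hol_fun_ops
    by (meson add_mono disc_seminorm_ge norm_triangle_le)
  have scale: "disc_seminorm k (c *\<^sub>C f) = norm c * disc_seminorm k f" for k c f
  proof (rule antisym)
    show "disc_seminorm k (c *\<^sub>C f) \<le> norm c * disc_seminorm k f"
      unfolding disc_seminorm_le_iff hol_fun_scaleC norm_mult
      by (intro ballI mult_left_mono disc_seminorm_ge) auto
    obtain w where "w \<in> cball 0 (disc_radius k)" "disc_seminorm k f = norm (hol_fun f w)"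
      using disc_seminorm_attained by blast
    then show "norm c * disc_seminorm k f \<le> disc_seminorm k (c *\<^sub>C f)"
      using disc_seminorm_ge[of w k "c *\<^sub>C f"] by (simp add: hol_fun_scaleC norm_mult)
  qed
  have sep: "f = 0" if "\<forall>k. disc_seminorm k f = 0" for f
  proof (rule hol_disc_eqI)
    fix z :: complex assume "z \<in> unit_disc"
    then obtain k where "norm z \<le> disc_radius k" using disc_radius_exhausts[of "norm z"] by auto
    then show "hol_fun f z = hol_fun 0 z"
      using disc_seminorm_ge[of z k f] that by (simp add: hol_fun_ops)
  qed
  show "\<exists>p :: nat \<Rightarrow> hol_disc \<Rightarrow> real.
      (\<forall>k. seminorm (p k)) \<and>
      (\<forall>x. (\<forall>k. p k x = 0) \<longrightarrow> x = 0) \<and>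
      (\<forall>U. open U \<longleftrightarrow> (\<forall>x\<in>U. \<exists>n. \<exists>\<epsilon>>0. \<forall>y. (\<forall>k\<le>n. p k (y - x) < \<epsilon>) \<longrightarrow> y \<in> U)) \<and>
      (\<forall>X. (\<forall>k. \<forall>\<epsilon>>0. \<exists>M. \<forall>i\<ge>M. \<forall>j\<ge>M. p k (X i - X j) < \<epsilon>) \<longrightarrow>
           (\<exists>x. \<forall>k. (\<lambda>i. p k (X i - x)) \<longlonglongrightarrow> 0))"
    using tri scale sep open_hol_disc_iff hol_disc_complete
    by (intro exI[of _ disc_seminorm]) (unfold seminorm_def, blast)
qed


section \<open>Composition operators and Koenigs' eigenfunction\<close>

definition comp_op :: "(complex \<Rightarrow> complex) \<Rightarrow> hol_disc \<Rightarrow> hol_disc" where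
  "comp_op \<phi> f = hol_of (hol_fun f \<circ> \<phi>)"

lemma hol_fun_comp_op:
  assumes "\<phi> holomorphic_on unit_disc" "\<phi> ` unit_disc \<subseteq> unit_disc" "z \<in> unit_disc"
  shows "hol_fun (comp_op \<phi> f) z = hol_fun f (\<phi> z)"
proof -
  have "hol_fun f \<circ> \<phi> holomorphic_on unit_disc"
    using assms by (intro holomorphic_on_compose_gen[OF _ hol_fun_holomorphic])
  then show ?thesis using assms(3) by (simp add: comp_op_def hol_fun_hol_of)
qed

definition koenigs :: "(complex \<Rightarrow> complex) \<Rightarrow> complex \<Rightarrow> hol_disc" where
  "koenigs \<phi> \<alpha> =
     (THE \<kappa>. comp_op \<phi> \<kappa> = deriv \<phi> \<alpha> *\<^sub>C \<kappa> \<and> deriv (hol_fun \<kappa>) \<alpha> = 1)"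

text \<open>The operators \<open>P\<^sub>n\<close> for a given base point \<open>\<alpha>\<close> and eigenfunction \<open>\<kappa>\<close>.\<close>

fun koenigs_proj :: "complex \<Rightarrow> hol_disc \<Rightarrow> nat \<Rightarrow> hol_disc \<Rightarrow> hol_disc" where
  "koenigs_proj \<alpha> \<kappa> 0 f = hol_fun f \<alpha> *\<^sub>C 1"
| "koenigs_proj \<alpha> \<kappa> (Suc n) f =
     (let g = f - (\<Sum>k<Suc n. koenigs_proj \<alpha> \<kappa> k f)
      in ((deriv ^^ Suc n) (hol_fun g) \<alpha> / fact (Suc n)) *\<^sub>C \<kappa> ^ Suc n)"

end

theory Submission
  imports Defs
begin

text \<open>
  Write \<open>\<delta> = \<phi>'(\<alpha>)\<close>, \<open>u(z) = z - \<alpha>\<close> and \<open>\<phi> - \<alpha> = u v\<close>, so that \<open>v(\<alpha>) = \<delta>\<close> and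
  \<open>C(u\<^sup>N h) = u\<^sup>N v\<^sup>N (h \<circ> \<phi>)\<close>. If \<open>\<bar>w(\<alpha>)\<bar> < \<bar>\<mu>\<bar>\<close>, then \<open>\<mu> - w C\<close> is invertible: its Neumann series
  converges locally uniformly because the iterates of \<open>\<phi>\<close> tend to \<open>\<alpha>\<close> uniformly on compact sets.
  For \<open>w = v\<^sup>N\<close> this inverts \<open>\<mu> - C\<close> on the functions vanishing to order \<open>N\<close> at \<open>\<alpha>\<close> as soon as
  \<open>\<bar>\<delta>\<bar>\<^sup>N < \<bar>\<mu>\<bar>\<close>. Modulo these functions \<open>C\<close> is diagonal in the basis \<open>\<kappa>\<^sup>0, \<dots>, \<kappa>\<^sup>N\<^sup>-\<^sup>1\<close> with
  eigenvalues \<open>\<delta>\<^sup>j\<close>, and \<open>P\<^sub>n\<close> picks the \<open>\<kappa>\<^sup>n\<close>-component. Hence every nonzero point of the spectrum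
  is some \<open>\<delta>\<^sup>n\<close>, a Riesz point with spectral projection \<open>P\<^sub>n\<close>.
\<close>

section \<open>Iterates near an attracting fixed point\<close>

text \<open>Differentiating \<open>g (f w) = w\<close> gives
  \<open>deriv g a * deriv f 0 = 1\<close>, so the conjugating factors cancel in the chain
  rule.\<close>

lemma deriv_conjugate_fixed_point:
  assumes f: "f holomorphic_on S" "open S" "0 \<in> S" and g: "g holomorphic_on T" "open T" "a \<in> T"
    and \<phi>: "\<phi> holomorphic_on T" and "g a = 0" "f 0 = a" "\<phi> a = a"
    and gf: "\<And>w. w \<in> S \<Longrightarrow> g (f w) = w"
  shows "deriv (\<lambda>w. g (\<phi> (f w))) 0 = deriv \<phi> a"
proof -
  have df: "(f has_field_derivative deriv f 0) (at 0)"
    and dg: "(g has_field_derivative deriv g a) (at a)"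
    and d\<phi>: "(\<phi> has_field_derivative deriv \<phi> a) (at a)"
    using assms by (auto intro: holomorphic_derivI)
  have "((g \<circ> f) has_field_derivative deriv g a * deriv f 0) (at 0)"
    by (rule DERIV_chain) (use df dg assms in auto)
  then have "((\<lambda>w. w) has_field_derivative deriv g a * deriv f 0) (at 0)"
    by (rule has_field_derivative_transform_within_open[of _ _ _ S]) (use assms in auto)
  then have 1: "deriv g a * deriv f 0 = 1"
    using DERIV_ident DERIV_unique by blast
  have "((g \<circ> (\<phi> \<circ> f)) has_field_derivative deriv g a * (deriv \<phi> a * deriv f 0)) (at 0)"
    by (intro DERIV_chain) (use df dg d\<phi> assms in auto)
  then have "deriv (\<lambda>w. g (\<phi> (f w))) 0 = (deriv g a * deriv f 0) * deriv \<phi> a"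
    by (simp add: DERIV_imp_deriv o_def mult_ac)
  then show ?thesis by (simp add: 1)
qed

text \<open>By the Schwarz lemma \<Phi>(z) = z h(z). As |\<Phi>'(0)| < 1 excludes rotations, |h| < 1
  on the whole disc, and \<open>q\<close> is the maximum of |h| on the closed disc of radius
  \<open>s\<close>.\<close>

lemma schwarz_contraction:
  assumes hol: "\<Phi> holomorphic_on unit_disc" and self: "\<Phi> ` unit_disc \<subseteq> unit_disc"
    and 0: "\<Phi> 0 = 0" and d: "norm (deriv \<Phi> 0) < 1" and s: "0 \<le> s" "s < 1"
  obtains q where "0 \<le> q" "q < 1" "\<And>w. norm w \<le> s \<Longrightarrow> norm (\<Phi> w) \<le> q * norm w"
proof -
  obtain h where h: "h holomorphic_on unit_disc" "\<And>z. norm z < 1 \<Longrightarrow> \<Phi> z = z * h z"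
      "deriv \<Phi> 0 = h 0"
    using Schwarz3[OF hol 0] by blast
  have no: "norm (\<Phi> z) < 1" if "norm z < 1" for z
    using self that by force
  have not_rot: "\<not> (\<exists>c. (\<forall>z. norm z < 1 \<longrightarrow> \<Phi> z = c * z) \<and> norm c = 1)"
  proof
    assume "\<exists>c. (\<forall>z. norm z < 1 \<longrightarrow> \<Phi> z = c * z) \<and> norm c = 1"
    then obtain c where c: "\<And>z. norm z < 1 \<Longrightarrow> \<Phi> z = c * z" "norm c = 1" by blast
    have "((\<lambda>z. c * z) has_field_derivative c) (at 0)"
      by (auto intro!: derivative_eq_intros)
    then have "(\<Phi> has_field_derivative c) (at 0)"
      by (rule has_field_derivative_transform_within_open[of _ _ _ unit_disc]) (use c in auto)
    then show False using DERIV_imp_deriv d c(2) by fastforce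
  qed
  have lt: "norm (h z) < 1" if "norm z < 1" for z
  proof (cases "z = 0")
    case False
    have "norm (\<Phi> z) \<le> norm z" "norm (\<Phi> z) \<noteq> norm z"
      using Schwarz_Lemma[OF hol 0 no that] not_rot False that by auto
    then have "norm z * norm (h z) < norm z * 1"
      using h(2)[OF that] by (simp add: norm_mult)
    then show ?thesis using False by (metis mult_less_cancel_left_pos zero_less_norm_iff)
  qed (use d h in simp)
  have "continuous_on (cball 0 s) (\<lambda>z. norm (h z))"
    using s by (intro continuous_on_norm holomorphic_on_imp_continuous_on
        holomorphic_on_subset[OF h(1)]) auto
  then obtain w where w: "norm w \<le> s" "\<And>z. norm z \<le> s \<Longrightarrow> norm (h z) \<le> norm (h w)"
    using continuous_attains_sup[of "cball 0 s" "\<lambda>z. norm (h z)"] s by auto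
  show ?thesis
  proof (rule that[of "norm (h w)"])
    show "norm (h w) < 1" using lt w s by auto
    fix z :: complex assume "norm z \<le> s"
    then show "norm (\<Phi> z) \<le> norm (h w) * norm z"
      using h(2)[of z] w(2)[of z] s by (simp add: norm_mult mult.commute mult_left_mono)
  qed auto
qed

text \<open>Conjugating the fixed point to \<open>0\<close>, closed discs around \<open>0\<close> are invariant by the Schwarz lemma.\<close>

lemma invariant_compact_exists:
  assumes hol: "\<phi> holomorphic_on unit_disc" and self: "\<phi> ` unit_disc \<subseteq> unit_disc"
    and \<alpha>: "\<alpha> \<in> unit_disc" and fp: "\<phi> \<alpha> = \<alpha>" and d: "norm (deriv \<phi> \<alpha>) < 1"
    and K: "compact K" "K \<subseteq> unit_disc"
  obtains L where "compact L" "L \<subseteq> unit_disc" "K \<subseteq> L" "\<phi> ` L \<subseteq> L"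
    "\<And>V. open V \<Longrightarrow> \<alpha> \<in> V \<Longrightarrow> \<exists>m. \<forall>k\<ge>m. (\<phi> ^^ k) ` L \<subseteq> V"
proof -
  \<comment> \<open>\<open>g\<close> is a disc automorphism moving \<alpha> to 0, and
    \<open>f\<close> is its inverse.\<close>
  obtain g f where gf: "g \<alpha> = 0"
      "g holomorphic_on unit_disc" "g ` unit_disc \<subseteq> unit_disc"
      "f holomorphic_on unit_disc" "f ` unit_disc \<subseteq> unit_disc"
      "\<And>z. z \<in> unit_disc \<Longrightarrow> g (f z) = z" "\<And>z. z \<in> unit_disc \<Longrightarrow> f (g z) = z"
    using ball_biholomorphism_exists[OF \<alpha>] by metis
  have f0: "f 0 = \<alpha>" using gf(1,7) \<alpha> by force
  define \<Phi> where "\<Phi> = (\<lambda>w. g (\<phi> (f w)))"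
  have hol\<Phi>: "\<Phi> holomorphic_on unit_disc"
    unfolding \<Phi>_def using gf self
    by (intro holomorphic_on_compose_gen[OF _ gf(2), unfolded o_def, of _ unit_disc]
        holomorphic_on_compose_gen[OF gf(4) hol, unfolded o_def] gf(5)) blast
  have self\<Phi>: "\<Phi> ` unit_disc \<subseteq> unit_disc" unfolding \<Phi>_def using gf(3,5) self by blast
  have \<Phi>0: "\<Phi> 0 = 0" by (simp add: \<Phi>_def f0 fp gf(1))
  have d\<Phi>: "norm (deriv \<Phi> 0) < 1"
    unfolding \<Phi>_def
    using deriv_conjugate_fixed_point[OF gf(4) _ _ gf(2) _ _ hol gf(1) f0 fp] \<alpha> gf(6) d by simp
  have "compact (g ` K)"
    using K gf(2) by (meson compact_continuous_image holomorphic_on_imp_continuous_on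
        holomorphic_on_subset)
  moreover have "g ` K \<subseteq> unit_disc" using K gf(3) by blast
  ultimately obtain k where k: "g ` K \<subseteq> cball 0 (disc_radius k)"
    using compact_disc_exhausted by blast
  define s where "s = disc_radius k"
  have s: "0 < s" "s < 1" using disc_radius s_def by auto
  obtain q where q: "0 \<le> q" "q < 1" "\<And>w. norm w \<le> s \<Longrightarrow> norm (\<Phi> w) \<le> q * norm w"
    using schwarz_contraction[OF hol\<Phi> self\<Phi> \<Phi>0 d\<Phi>, of s] s by auto
  define L where "L = f ` cball 0 s"
  have sub: "cball 0 s \<subseteq> unit_disc" using s by auto
  \<comment> \<open>The three claims go together: the bound by \<open>s\<close> is what allows the
    contraction estimate and the conjugacy of \<phi> and \<Phi> to be used at the next
    iterate.\<close>
  have iter: "norm ((\<Phi> ^^ n) w) \<le> q ^ n * s \<and> norm ((\<Phi> ^^ n) w) \<le> s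
      \<and> (\<phi> ^^ n) (f w) = f ((\<Phi> ^^ n) w)" if w: "norm w \<le> s" for n w
  proof (induction n)
    case 0
    then show ?case using w by simp
  next
    case (Suc n)
    let ?w = "(\<Phi> ^^ n) w"
    have "norm (\<Phi> ?w) \<le> q * norm ?w" using q(3) Suc by blast
    also have "\<dots> \<le> q * (q ^ n * s)" using Suc q(1) by (intro mult_left_mono) auto
    finally have 1: "norm (\<Phi> ?w) \<le> q ^ Suc n * s" by simp
    have "q ^ Suc n * s \<le> 1 * s" using q(1,2) s by (intro mult_right_mono power_le_one) auto
    then have 2: "norm (\<Phi> ?w) \<le> s" using 1 by simp
    have "?w \<in> unit_disc" using Suc s by auto
    then have "f ?w \<in> unit_disc" using gf(5) by blast
    then have "\<phi> (f ?w) \<in> unit_disc" using self by blast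
    then have "f (\<Phi> ?w) = \<phi> (f ?w)" unfolding \<Phi>_def using gf(7) by blast
    then show ?case using 1 2 Suc by simp
  qed
  show ?thesis
  proof (rule that[of L])
    show "compact L" unfolding L_def
      using gf(4) sub by (meson compact_cball compact_continuous_image
          holomorphic_on_imp_continuous_on holomorphic_on_subset)
    show "L \<subseteq> unit_disc" unfolding L_def using gf(5) sub by blast
    show "K \<subseteq> L"
    proof
      fix z assume "z \<in> K"
      then have "z = f (g z)" "g z \<in> cball 0 s" using gf(7) k K s_def by force+
      then show "z \<in> L" unfolding L_def by blast
    qed
    show "\<phi> ` L \<subseteq> L"
      unfolding L_def using iter[of _ 1] by force
    fix V assume V: "open V" "\<alpha> \<in> V"
    have "isCont f 0"
      using gf(4) by (intro continuous_on_interior[of unit_disc])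
        (auto intro: holomorphic_on_imp_continuous_on)
    then obtain r where r: "r > 0" "\<And>w. norm w < r \<Longrightarrow> f w \<in> V"
      using V f0 unfolding continuous_at_open by (metis dist_0_norm dist_commute open_dist)
    have "(\<lambda>n. q ^ n * s) \<longlonglongrightarrow> 0"
      using q by (intro tendsto_mult_left_zero LIMSEQ_power_zero) auto
    then obtain m where "\<forall>n\<ge>m. norm (q ^ n * s - 0) < r" using LIMSEQ_D r(1) by blast
    then have m: "q ^ n * s < r" if "n \<ge> m" for n using that by fastforce
    show "\<exists>m. \<forall>k\<ge>m. (\<phi> ^^ k) ` L \<subseteq> V"
    proof (intro exI[of _ m] allI impI subsetI)
      fix n z assume n: "n \<ge> m" and "z \<in> (\<phi> ^^ n) ` L"
      then obtain w where "norm w \<le> s" "z = (\<phi> ^^ n) (f w)" unfolding L_def by auto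
      then show "z \<in> V" using iter[of w n] r(2) m[OF n] by (metis order_le_less_trans)
    qed
  qed
qed

text \<open>Past some index \<open>m\<close> the orbits of \<open>L\<close> stay where |a| < \<rho>.
  Only the first \<open>m\<close> factors can exceed \<rho>, each by a ratio of at most
  \<open>B / \<rho>\<close>, so \<open>M = (B / \<rho>) ^ m\<close> works.\<close>

lemma cocycle_bound:
  fixes a \<phi> :: "complex \<Rightarrow> complex"
  assumes a: "continuous_on unit_disc a" "norm (a \<alpha>) < \<rho>" and \<alpha>: "\<alpha> \<in> unit_disc"
    and L: "compact L" "L \<subseteq> unit_disc" "\<phi> ` L \<subseteq> L"
    and attr: "\<And>V. open V \<Longrightarrow> \<alpha> \<in> V \<Longrightarrow> \<exists>m. \<forall>k\<ge>m. (\<phi> ^^ k) ` L \<subseteq> V"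
  obtains M where "0 < M" "\<And>k z. z \<in> L \<Longrightarrow> norm (\<Prod>i<k. a ((\<phi> ^^ i) z)) \<le> M * \<rho> ^ k"
proof -
  have \<rho>: "\<rho> > 0" using a(2) by (meson norm_ge_zero order_le_less_trans)
  have "compact (a ` L)" 
    by (intro compact_continuous_image continuous_on_subset[OF a(1) L(2)] L(1))
  from compact_imp_bounded[OF this]
  obtain B0 where B0: "\<And>z. z \<in> L \<Longrightarrow> norm (a z) \<le> B0"
    unfolding bounded_iff by auto
  \<comment> \<open>Taking the maximum with \<rho> makes \<open>B / \<rho>\<close> at least 1, so
    its powers increase with the exponent.\<close>
  define B where "B = max B0 \<rho>"
  have B: "norm (a z) \<le> B" if "z \<in> L" for z using B0[OF that] by (simp add: B_def)
  have B\<rho>: "1 \<le> B / \<rho>" using \<rho> by (simp add: B_def)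
  have "open (unit_disc \<inter> a -` ball 0 \<rho>)"
    using a(1) by (intro continuous_open_preimage) auto
  then obtain m where m: "\<And>k. k \<ge> m \<Longrightarrow> (\<phi> ^^ k) ` L \<subseteq> unit_disc \<inter> a -` ball 0 \<rho>"
    using attr[of "unit_disc \<inter> a -` ball 0 \<rho>"] \<alpha> a(2) by auto
  have inv: "(\<phi> ^^ i) z \<in> L" if "z \<in> L" for i z
    using L(3) that by (induction i) auto
  \<comment> \<open>The exponent \<open>min k m\<close> counts the factors taken before the orbit
    has settled near \<alpha>.\<close>
  have "norm (\<Prod>i<k. a ((\<phi> ^^ i) z)) \<le> (B / \<rho>) ^ min k m * \<rho> ^ k" if z: "z \<in> L" for k z
  proof (induction k)
    case 0
    then show ?case by simp
  next
    case (Suc k)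
    have c: "norm (a ((\<phi> ^^ k) z)) \<le> (if k < m then B / \<rho> else 1) * \<rho>"
    proof (cases "k < m")
      case False
      then have "(\<phi> ^^ k) z \<in> a -` ball 0 \<rho>" using m[of k] z by auto
      then show ?thesis using False by simp
    qed (use B[OF inv[OF z]] \<rho> in simp)
    have "norm (\<Prod>i<Suc k. a ((\<phi> ^^ i) z)) =
        norm (\<Prod>i<k. a ((\<phi> ^^ i) z)) * norm (a ((\<phi> ^^ k) z))"
      by (simp add: norm_mult)
    also have "\<dots> \<le> ((B / \<rho>) ^ min k m * \<rho> ^ k) * ((if k < m then B / \<rho> else 1) * \<rho>)"
      using Suc c B\<rho> \<rho> by (intro mult_mono) auto
    also have "\<dots> = (B / \<rho>) ^ min (Suc k) m * \<rho> ^ Suc k"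
      by (simp add: min_def not_less le_antisym mult_ac) (metis le_antisym not_less_eq_eq)
    finally show ?case .
  qed
  also have "(B / \<rho>) ^ min k m * \<rho> ^ k \<le> (B / \<rho>) ^ m * \<rho> ^ k" for k
    using B\<rho> \<rho> by (intro mult_right_mono power_increasing) auto
  finally show ?thesis
    using B\<rho> by (intro that[of "(B / \<rho>) ^ m"]) auto
qed

section \<open>Weighted composition operators\<close>

locale attracting_fixed_point =
  fixes \<phi> :: "complex \<Rightarrow> complex" and \<alpha> :: complex
  assumes hol: "\<phi> holomorphic_on unit_disc" and self: "\<phi> ` unit_disc \<subseteq> unit_disc"
    and \<alpha>: "\<alpha> \<in> unit_disc" and fp: "\<phi> \<alpha> = \<alpha>"
    and deriv_pos: "0 < norm (deriv \<phi> \<alpha>)" and deriv_less: "norm (deriv \<phi> \<alpha>) < 1"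
begin

lemma in_disc: "z \<in> unit_disc \<Longrightarrow> \<phi> z \<in> unit_disc"
  using self by blast

lemma iter_in_disc: "z \<in> unit_disc \<Longrightarrow> (\<phi> ^^ k) z \<in> unit_disc"
  by (induction k) (use in_disc in auto)

lemma iter_holomorphic: "(\<phi> ^^ k) holomorphic_on unit_disc"
proof (induction k)
  case (Suc k)
  have "\<phi> \<circ> (\<phi> ^^ k) holomorphic_on unit_disc"
    using iter_in_disc by (intro holomorphic_on_compose_gen[OF Suc hol]) blast
  then show ?case by (simp add: o_def)
qed (simp add: id_def)

lemma hol_fun_iter_holomorphic: "(\<lambda>z. hol_fun f ((\<phi> ^^ k) z)) holomorphic_on unit_disc"
  using iter_in_disc
  by (intro holomorphic_on_compose_gen[OF iter_holomorphic hol_fun_holomorphic, unfolded o_def]) blast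

lemmas hol_fun_comp = hol_fun_comp_op[OF hol self]

text \<open>The product is the k-th iterate of the operator f \<mapsto> w (f \<circ> \<phi>) applied
  to \<open>h\<close>, evaluated at \<open>z\<close>. Orbits starting in \<open>K\<close> stay in an
  invariant compact set, where \<open>cocycle_bound\<close> applies and \<open>h\<close> is
  bounded.\<close>

lemma weighted_orbit_bound:
  assumes w: "norm (hol_fun w \<alpha>) < \<rho>" and K: "compact K" "K \<subseteq> unit_disc"
  obtains M where "0 < M"
    "\<And>k z. z \<in> K \<Longrightarrow> norm ((\<Prod>i<k. hol_fun w ((\<phi> ^^ i) z)) * hol_fun h ((\<phi> ^^ k) z)) \<le> M * \<rho> ^ k"
proof -
  obtain L where L: "compact L" "L \<subseteq> unit_disc" "K \<subseteq> L" "\<phi> ` L \<subseteq> L"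
      "\<And>V. open V \<Longrightarrow> \<alpha> \<in> V \<Longrightarrow> \<exists>m. \<forall>k\<ge>m. (\<phi> ^^ k) ` L \<subseteq> V"
    using invariant_compact_exists[OF hol self \<alpha> fp deriv_less K] by metis
  have cont: "continuous_on unit_disc (hol_fun f)" for f
    by (simp add: hol_fun_holomorphic holomorphic_on_imp_continuous_on)
  obtain M where M: "0 < M" "\<And>k z. z \<in> L \<Longrightarrow> norm (\<Prod>i<k. hol_fun w ((\<phi> ^^ i) z)) \<le> M * \<rho> ^ k"
    using cocycle_bound[OF cont w \<alpha> L(1,2,4,5)] by metis
  have "compact (hol_fun h ` L)"
    by (intro compact_continuous_image continuous_on_subset[OF cont L(2)] L(1))
  from compact_imp_bounded[OF this]
  obtain H where H: "0 < H" "\<And>z. z \<in> L \<Longrightarrow> norm (hol_fun h z) \<le> H"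
    unfolding bounded_pos by auto
  have \<rho>: "\<rho> > 0" using w by (meson norm_ge_zero order_le_less_trans)
  have inv: "(\<phi> ^^ i) z \<in> L" if "z \<in> L" for i z
    using L(4) that by (induction i) auto
  show ?thesis
  proof (rule that[of "M * H"])
    fix k z assume "z \<in> K"
    then have "z \<in> L" using L(3) by blast
    then have "norm (\<Prod>i<k. hol_fun w ((\<phi> ^^ i) z)) * norm (hol_fun h ((\<phi> ^^ k) z)) \<le> M * \<rho> ^ k * H"
      using M H inv \<rho> by (intro mult_mono) auto
    then show "norm ((\<Prod>i<k. hol_fun w ((\<phi> ^^ i) z)) * hol_fun h ((\<phi> ^^ k) z)) \<le> M * H * \<rho> ^ k"
      by (simp add: norm_mult mult_ac)
  qed (use M H in simp)
qed

section \<open>Injectivity and surjectivity of \<mu> - w C\<close>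

text \<open>Iterating the equation k times expresses \<mu>^k g(z) through the k-th orbit product.
  For \<rho> strictly between |w(\<alpha>)| and |\<mu>| this bounds |g(z)| by a constant times
  (\<rho> / |\<mu>|)^k, which tends to 0.\<close>

lemma weighted_eigenfunction_zero:
  assumes w: "norm (hol_fun w \<alpha>) < norm \<mu>" and g: "\<mu> *\<^sub>C g = w * comp_op \<phi> g"
  shows "g = 0"
proof (rule hol_disc_eqI)
  fix z :: complex assume z: "z \<in> unit_disc"
  obtain \<rho> where \<rho>: "norm (hol_fun w \<alpha>) < \<rho>" "\<rho> < norm \<mu>" using dense[OF w] by blast
  have \<rho>0: "0 < \<rho>" using \<rho>(1) by (meson norm_ge_zero order_le_less_trans)
  then have q: "norm (\<rho> / norm \<mu>) < 1" using \<rho>(2) by (simp add: divide_less_eq)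
  obtain M where M: "\<And>k. norm ((\<Prod>i<k. hol_fun w ((\<phi> ^^ i) z)) * hol_fun g ((\<phi> ^^ k) z)) \<le> M * \<rho> ^ k"
    using weighted_orbit_bound[OF \<rho>(1), of "{z}" g] z by auto
  have eq: "\<mu> * hol_fun g y = hol_fun w y * hol_fun g (\<phi> y)" if "y \<in> unit_disc" for y
    using arg_cong[OF g, of "\<lambda>f. hol_fun f y"] that by (simp add: hol_fun_scaleC hol_fun_ops hol_fun_comp)
  have it: "\<mu> ^ k * hol_fun g z = (\<Prod>i<k. hol_fun w ((\<phi> ^^ i) z)) * hol_fun g ((\<phi> ^^ k) z)" for k
  proof (induction k)
    case (Suc k)
    have "\<mu> ^ Suc k * hol_fun g z = (\<Prod>i<k. hol_fun w ((\<phi> ^^ i) z)) * (\<mu> * hol_fun g ((\<phi> ^^ k) z))"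
      using Suc by (simp add: mult_ac)
    then show ?case using eq[OF iter_in_disc[OF z, of k]] by simp
  qed simp
  have "norm (hol_fun g z) \<le> M * (\<rho> / norm \<mu>) ^ k" for k
  proof -
    have "norm \<mu> ^ k * norm (hol_fun g z) \<le> M * \<rho> ^ k"
      using M[of k] unfolding it[symmetric] by (simp add: norm_mult norm_power)
    moreover have "0 < norm \<mu> ^ k" using \<rho> \<rho>0 by (intro zero_less_power) auto
    ultimately show ?thesis by (simp add: power_divide pos_le_divide_eq mult.commute)
  qed
  moreover have "(\<lambda>k. M * (\<rho> / norm \<mu>) ^ k) \<longlonglongrightarrow> 0"
    using q by (intro tendsto_mult_right_zero LIMSEQ_power_zero) simp
  ultimately have "norm (hol_fun g z) \<le> 0"
    by (intro LIMSEQ_le_const) auto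
  then show "hol_fun g z = hol_fun 0 z" by (simp add: hol_fun_ops)
qed

text \<open>The solution is the Neumann series with terms (w C)^k h / \<mu>^(k+1). On each compact
  set it is dominated by a geometric series of ratio \<rho> / |\<mu>|, so its sum is
  holomorphic.\<close>

lemma weighted_resolvent_exists:
  assumes w: "norm (hol_fun w \<alpha>) < norm \<mu>"
  obtains g where "\<mu> *\<^sub>C g - w * comp_op \<phi> g = h"
proof -
  obtain \<rho> where \<rho>: "norm (hol_fun w \<alpha>) < \<rho>" "\<rho> < norm \<mu>" using dense[OF w] by blast
  have \<rho>0: "0 < \<rho>" using \<rho>(1) by (meson norm_ge_zero order_le_less_trans)
  then have q: "norm (\<rho> / norm \<mu>) < 1" using \<rho>(2) by (simp add: divide_less_eq)
  have \<mu>0: "\<mu> \<noteq> 0" using \<rho> \<rho>0 by auto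
  define t where "t k z = (\<Prod>i<k. hol_fun w ((\<phi> ^^ i) z)) * hol_fun h ((\<phi> ^^ k) z) / \<mu> ^ Suc k" for k z
  have t_bound: "\<exists>N. (\<forall>k. \<forall>z\<in>K. norm (t k z) \<le> N k) \<and> summable N"
    if K: "compact K" "K \<subseteq> unit_disc" for K
  proof -
    obtain M where M: "\<And>k z. z \<in> K \<Longrightarrow>
        norm ((\<Prod>i<k. hol_fun w ((\<phi> ^^ i) z)) * hol_fun h ((\<phi> ^^ k) z)) \<le> M * \<rho> ^ k"
      using weighted_orbit_bound[where h = h, OF \<rho>(1) K] by metis
    have "norm (t k z) \<le> M / norm \<mu> * (\<rho> / norm \<mu>) ^ k" if "z \<in> K" for k z
    proof -
      have "norm (t k z) \<le> M * \<rho> ^ k / norm \<mu> ^ Suc k"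
        unfolding t_def norm_divide norm_power using M[OF that] by (intro divide_right_mono) auto
      then show ?thesis by (simp add: power_divide)
    qed
    moreover have "summable (\<lambda>k. M / norm \<mu> * (\<rho> / norm \<mu>) ^ k)"
      using q by (intro summable_mult summable_geometric) simp
    ultimately show ?thesis by (intro exI[of _ "\<lambda>k. M / norm \<mu> * (\<rho> / norm \<mu>) ^ k"]) auto
  qed
  have t_summable: "summable (\<lambda>k. t k z)" if "z \<in> unit_disc" for z
  proof -
    obtain N where "\<forall>k. norm (t k z) \<le> N k" "summable N"
      using t_bound[of "{z}"] \<open>z \<in> unit_disc\<close> by auto
    then show ?thesis by (auto intro: summable_comparison_test'[of N 0])
  qed
  have t_hol: "t k holomorphic_on unit_disc" for k
    unfolding t_def using \<mu>0 by (intro holomorphic_intros hol_fun_iter_holomorphic) auto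
  define g where "g z = (\<Sum>k. t k z)" for z
  have "g holomorphic_on unit_disc"
  proof (rule holomorphic_uniform_sequence[where f = "\<lambda>n z. \<Sum>k<n. t k z"])
    show "(\<lambda>z. \<Sum>k<n. t k z) holomorphic_on unit_disc" for n
      by (intro holomorphic_intros t_hol)
    fix x :: complex assume x: "x \<in> unit_disc"
    obtain e where e: "e > 0" "cball x e \<subseteq> unit_disc"
      using x open_contains_cball[of unit_disc] open_ball by blast
    obtain N where "\<forall>k. \<forall>z\<in>cball x e. norm (t k z) \<le> N k" "summable N"
      using t_bound[OF compact_cball e(2)] by blast
    then have "uniform_limit (cball x e) (\<lambda>n z. \<Sum>k<n. t k z) g sequentially"
      unfolding g_def by (intro Weierstrass_m_test) auto
    then show "\<exists>d>0. cball x d \<subseteq> unit_disc \<and>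
        uniform_limit (cball x d) (\<lambda>n z. \<Sum>k<n. t k z) g sequentially"
      using e by blast
  qed simp
  then have g: "hol_fun (hol_of g) z = g z" if "z \<in> unit_disc" for z
    using that by (simp add: hol_fun_hol_of)
  have "\<mu> *\<^sub>C hol_of g - w * comp_op \<phi> (hol_of g) = h"
  proof (rule hol_disc_eqI)
    fix z :: complex assume z: "z \<in> unit_disc"
    \<comment> \<open>Shifting the orbit product by one turns the k-th term at \<phi>(z) into the
      next term at \<open>z\<close>, so applying w C shifts the series and only the term for k = 0
      survives.\<close>
    have step: "\<mu> * t (Suc k) z = hol_fun w z * t k (\<phi> z)" for k
    proof -
      have "(\<Prod>i<Suc k. hol_fun w ((\<phi> ^^ i) z)) = hol_fun w z * (\<Prod>i<k. hol_fun w ((\<phi> ^^ i) (\<phi> z)))"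
        unfolding prod.lessThan_Suc_shift by (simp add: funpow_swap1)
      then show ?thesis using \<mu>0 by (simp add: t_def funpow_swap1 field_simps del: prod.lessThan_Suc)
    qed
    have "summable (\<lambda>k. t (Suc k) z)"
      using t_summable[OF z] by (subst summable_Suc_iff)
    then have "\<mu> * g z = \<mu> * t 0 z + (\<Sum>k. \<mu> * t (Suc k) z)"
      unfolding g_def suminf_split_initial_segment[OF t_summable[OF z], of 1]
      by (simp add: suminf_mult distrib_left add.commute)
    also have "(\<Sum>k. \<mu> * t (Suc k) z) = hol_fun w z * g (\<phi> z)"
      unfolding step g_def by (rule suminf_mult[OF t_summable[OF in_disc[OF z]]])
    also have "\<mu> * t 0 z = hol_fun h z" using \<mu>0 by (simp add: t_def)
    finally show "hol_fun (\<mu> *\<^sub>C hol_of g - w * comp_op \<phi> (hol_of g)) z = hol_fun h z"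
      using z g in_disc[OF z] by (simp add: hol_fun_ops hol_fun_scaleC hol_fun_comp)
  qed
  then show ?thesis by (rule that)
qed

end

section \<open>Continuous functionals and factorization of holomorphic functions\<close>

lemma hol_disc_mult_scaleC_right: "f * c *\<^sub>C g = c *\<^sub>C (f * g :: hol_disc)"
  by (rule hol_disc_eqI) (simp add: hol_fun_ops hol_fun_scaleC)

text \<open>Additivity reduces continuity at \<open>f\<close> to the bound for \<open>g - f\<close>.
  Stating the bound through any upper bound \<open>e\<close> avoids a supremum over
  \<open>K\<close>, which may be empty.\<close>

lemma hol_functional_continuous:
  fixes F :: "hol_disc \<Rightarrow> complex"
  assumes diff: "\<And>f g. F (f - g) = F f - F g" and K: "compact K" "K \<subseteq> unit_disc" and B: "B > 0"
    and bound: "\<And>f e. e > 0 \<Longrightarrow> (\<And>z. z \<in> K \<Longrightarrow> norm (hol_fun f z) \<le> e) \<Longrightarrow> norm (F f) \<le> B * e"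
  shows "continuous_on UNIV F"
  unfolding continuous_on_open_vimage[OF open_UNIV]
proof (intro allI impI)
  fix V :: "complex set" assume V: "open V"
  show "open (F -` V \<inter> UNIV)"
    unfolding open_hol_disc_def
  proof
    fix f assume "f \<in> F -` V \<inter> UNIV"
    then obtain e where e: "e > 0" "ball (F f) e \<subseteq> V"
      using V by (metis IntD1 open_contains_ball vimageD)
    define \<epsilon> where "\<epsilon> = e / (2 * B)"
    have \<epsilon>: "\<epsilon> > 0" "B * \<epsilon> < e" using e(1) B by (auto simp: \<epsilon>_def)
    have "g \<in> F -` V \<inter> UNIV" if g: "\<forall>z\<in>K. norm (hol_fun g z - hol_fun f z) < \<epsilon>" for g
    proof -
      have "norm (F (g - f)) \<le> B * \<epsilon>"
        using g by (intro bound \<epsilon>) (auto simp: hol_fun_ops intro: less_imp_le)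
      then have "F g \<in> ball (F f) e"
        using \<epsilon>(2) by (simp add: diff dist_norm norm_minus_commute)
      then show ?thesis using e(2) by blast
    qed
    then show "\<exists>K \<epsilon>. compact K \<and> K \<subseteq> unit_disc \<and> \<epsilon> > 0 \<and>
        (\<forall>g. (\<forall>z\<in>K. norm (hol_fun g z - hol_fun f z) < \<epsilon>) \<longrightarrow> g \<in> F -` V \<inter> UNIV)"
      using K \<epsilon>(1) by blast
  qed
qed

lemma hol_fun_continuous: "continuous_on UNIV (\<lambda>f. hol_fun f z)"
proof (cases "z \<in> unit_disc")
  case True
  then show ?thesis
    by (intro hol_functional_continuous[where K = "{z}" and B = 1]) (auto simp: hol_fun_ops)
qed (simp add: hol_fun_outside)

lemma higher_deriv_hol_diff:
  "a \<in> unit_disc \<Longrightarrow> (deriv ^^ n) (hol_fun (f - g)) a = (deriv ^^ n) (hol_fun f) a - (deriv ^^ n) (hol_fun g) a"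
  using higher_deriv_diff[OF hol_fun_holomorphic[of f] hol_fun_holomorphic[of g], of a n]
  by (simp add: hol_fun_ops[abs_def])

lemma higher_deriv_hol_add:
  "a \<in> unit_disc \<Longrightarrow> (deriv ^^ n) (hol_fun (f + g)) a = (deriv ^^ n) (hol_fun f) a + (deriv ^^ n) (hol_fun g) a"
  using higher_deriv_add[OF hol_fun_holomorphic[of f] hol_fun_holomorphic[of g], of a n]
  by (simp add: hol_fun_ops[abs_def])

lemma higher_deriv_hol_scaleC:
  "a \<in> unit_disc \<Longrightarrow> (deriv ^^ n) (hol_fun (c *\<^sub>C f)) a = c * (deriv ^^ n) (hol_fun f) a"
  using higher_deriv_cmult[OF hol_fun_holomorphic[of f], of a n c]
  by (simp add: hol_fun_scaleC[abs_def])

lemma higher_deriv_hol_sum: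
  assumes "a \<in> unit_disc"
  shows "(deriv ^^ n) (hol_fun (sum f A)) a = (\<Sum>k\<in>A. (deriv ^^ n) (hol_fun (f k)) a)"
proof -
  have "(deriv ^^ n) (hol_fun 0) a = 0"
    using higher_deriv_hol_diff[OF assms, of n 0 0] by simp
  then show ?thesis
    by (induction A rule: infinite_finite_induct) (auto simp: higher_deriv_hol_add[OF assms])
qed

text \<open>Cauchy's inequality on a small closed disc around \<open>a\<close> supplies the bound,
  with constant \<open>fact n / r ^ n\<close>.\<close>

lemma higher_deriv_hol_continuous:
  assumes a: "a \<in> unit_disc"
  shows "continuous_on UNIV (\<lambda>f. (deriv ^^ n) (hol_fun f) a)"
proof -
  obtain r where r: "r > 0" "cball a r \<subseteq> unit_disc"
    using a open_contains_cball[of unit_disc] open_ball by blast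
  show ?thesis
  proof (rule hol_functional_continuous[where K = "cball a r" and B = "fact n / r ^ n"])
    fix f e assume e: "\<And>z. z \<in> cball a r \<Longrightarrow> norm (hol_fun f z) \<le> e"
    have "norm ((deriv ^^ n) (hol_fun f) a) \<le> fact n * e / r ^ n"
    proof (rule Cauchy_inequality)
      show "hol_fun f holomorphic_on ball a r"
        using r(2) by (intro holomorphic_on_subset[OF hol_fun_holomorphic]) auto
      show "continuous_on (cball a r) (hol_fun f)"
        using r(2) by (intro holomorphic_on_imp_continuous_on holomorphic_on_subset[OF hol_fun_holomorphic])
    qed (use r e in \<open>auto simp: dist_norm\<close>)
    then show "norm ((deriv ^^ n) (hol_fun f) a) \<le> fact n / r ^ n * e" by simp
  qed (use r in \<open>auto simp: higher_deriv_hol_diff[OF a]\<close>)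
qed

section \<open>Division by powers of z - a\<close>

definition lin :: "complex \<Rightarrow> hol_disc" where
  "lin a = hol_of (\<lambda>z. z - a)"

lemma hol_fun_lin: "z \<in> unit_disc \<Longrightarrow> hol_fun (lin a) z = z - a"
  unfolding lin_def by (subst hol_fun_hol_of) (auto intro!: holomorphic_intros)

text \<open>The difference quotient at \<open>a\<close> has a removable singularity, filled by the
  derivative.\<close>

lemma hol_disc_factor:
  assumes a: "a \<in> unit_disc"
  obtains h where "f = hol_fun f a *\<^sub>C 1 + lin a * h" "hol_fun h a = deriv (hol_fun f) a"
proof -
  let ?h = "\<lambda>z. if z = a then deriv (hol_fun f) a else (hol_fun f z - hol_fun f a) / (z - a)"
  have "hol_fun (hol_of ?h) z = ?h z" if "z \<in> unit_disc" for z
    using that pole_lemma_open[OF hol_fun_holomorphic[of f], of a] by (simp add: hol_fun_hol_of)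
  then show ?thesis
    using a by (intro that[of "hol_of ?h"] hol_disc_eqI)
      (auto simp: hol_fun_ops hol_fun_scaleC hol_fun_lin)
qed

lemma hol_disc_factor_zero:
  assumes a: "a \<in> unit_disc" and 0: "hol_fun f a = 0"
  obtains h where "f = lin a * h" "hol_fun h a = deriv (hol_fun f) a"
proof -
  obtain h where "f = hol_fun f a *\<^sub>C 1 + lin a * h" "hol_fun h a = deriv (hol_fun f) a"
    using hol_disc_factor[OF a] by blast
  then show ?thesis using 0 that by (metis add_0 complex_vector.scale_zero_left)
qed

text \<open>Cauchy's formula for the n-th derivative of the product and Cauchy's formula for
  \<open>h\<close> have the same integrand on the circle. Comparing the two values replaces an
  iterated product rule.\<close>

lemma higher_deriv_lin_power_mult:
  assumes a: "a \<in> unit_disc"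
  shows "(deriv ^^ n) (hol_fun (lin a ^ n * h)) a = fact n * hol_fun h a"
proof -
  obtain r where r: "r > 0" "cball a r \<subseteq> unit_disc"
    using a open_contains_cball[of unit_disc] open_ball by blast
  have hol: "hol_fun f holomorphic_on cball a r" for f
    using r(2) by (intro holomorphic_on_subset[OF hol_fun_holomorphic])
  have 1: "((\<lambda>u. hol_fun (lin a ^ n * h) u / (u - a) ^ Suc n) has_contour_integral
      (2 * pi * \<i> / fact n * (deriv ^^ n) (hol_fun (lin a ^ n * h)) a)) (circlepath a r)"
    using r hol by (intro Cauchy_has_contour_integral_higher_derivative_circlepath)
      (auto intro: holomorphic_on_imp_continuous_on holomorphic_on_subset[OF hol ball_subset_cball])
  have 2: "((\<lambda>u. hol_fun (lin a ^ n * h) u / (u - a) ^ Suc n) has_contour_integral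
      (2 * of_real pi * \<i> * hol_fun h a)) (circlepath a r)"
  proof (rule has_contour_integral_eq)
    show "((\<lambda>u. hol_fun h u / (u - a)) has_contour_integral (2 * of_real pi * \<i> * hol_fun h a)) (circlepath a r)"
      using r hol by (intro Cauchy_integral_circlepath_simple) auto
    fix u assume u: "u \<in> path_image (circlepath a r)"
    then have "u \<in> unit_disc" "u \<noteq> a" using r by auto
    then show "hol_fun h u / (u - a) = hol_fun (lin a ^ n * h) u / (u - a) ^ Suc n"
      by (simp add: hol_fun_ops hol_fun_power hol_fun_lin)
  qed
  show ?thesis
    using has_contour_integral_unique[OF 1 2] by (simp add: field_simps)
qed

lemma deriv_lin_mult:
  "a \<in> unit_disc \<Longrightarrow> deriv (hol_fun (lin a * h)) a = hol_fun h a"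
  using higher_deriv_lin_power_mult[of a 1 h] by simp

text \<open>Away from \<open>a\<close> one divides by z - a; at \<open>a\<close> the values of
  \<open>f\<close> and \<open>g\<close> are the derivatives of the two products.\<close>

lemma lin_cancel:
  assumes a: "a \<in> unit_disc" and eq: "lin a * f = lin a * g"
  shows "f = g"
proof (rule hol_disc_eqI)
  fix z :: complex assume z: "z \<in> unit_disc"
  show "hol_fun f z = hol_fun g z"
  proof (cases "z = a")
    case True
    then show ?thesis using deriv_lin_mult[OF a] eq by metis
  next
    case False
    have "(z - a) * hol_fun f z = (z - a) * hol_fun g z"
      using arg_cong[OF eq, of "\<lambda>h. hol_fun h z"] z by (simp add: hol_fun_ops hol_fun_lin)
    then show ?thesis using False by simp
  qed
qed

lemma lin_power_cancel:
  "a \<in> unit_disc \<Longrightarrow> lin a ^ n * f = lin a ^ n * g \<Longrightarrow> f = g"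
proof (induction n)
  case (Suc n)
  then show ?case using lin_cancel[of a "lin a ^ n * f" "lin a ^ n * g"] by (simp add: mult_ac)
qed simp

text \<open>The empty sum covers n = 0, so this single equation replaces both recursion equations
  from here on.\<close>

lemma koenigs_proj_eq:
  "koenigs_proj a \<kappa> n f =
     ((deriv ^^ n) (hol_fun (f - (\<Sum>k<n. koenigs_proj a \<kappa> k f))) a / fact n) *\<^sub>C \<kappa> ^ n"
  by (cases n) (simp_all add: Let_def)

declare koenigs_proj.simps [simp del]

section \<open>Koenigs' eigenfunction and the spectrum\<close>

context attracting_fixed_point
begin

section \<open>The composition operator as a continuous algebra homomorphism\<close>

text \<open>Closeness of the images on \<open>K\<close> is closeness of the functions on \<phi>(K),
  which is again compact in the disc.\<close>

lemma comp_op_continuous: "continuous_on UNIV (comp_op \<phi>)"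
  unfolding continuous_on_open_vimage[OF open_UNIV]
proof (intro allI impI)
  fix V :: "hol_disc set" assume V: "open V"
  show "open (comp_op \<phi> -` V \<inter> UNIV)"
    unfolding open_hol_disc_def
  proof
    fix f assume "f \<in> comp_op \<phi> -` V \<inter> UNIV"
    then obtain K e where K: "compact K" "K \<subseteq> unit_disc" "e > 0"
        "\<And>g. (\<forall>z\<in>K. norm (hol_fun g z - hol_fun (comp_op \<phi> f) z) < e) \<Longrightarrow> g \<in> V"
    proof -
      have "comp_op \<phi> f \<in> V" using \<open>f \<in> comp_op \<phi> -` V \<inter> UNIV\<close> by blast
      then show ?thesis using V that unfolding open_hol_disc_def by blast
    qed
    have "compact (\<phi> ` K)"
      using K by (intro compact_continuous_image holomorphic_on_imp_continuous_on
          holomorphic_on_subset[OF hol])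
    moreover have "\<phi> ` K \<subseteq> unit_disc" using K self by blast
    moreover have "g \<in> comp_op \<phi> -` V \<inter> UNIV"
      if "\<forall>z\<in>\<phi> ` K. norm (hol_fun g z - hol_fun f z) < e" for g
      using that K(2) by (auto intro!: K(4) simp: hol_fun_comp subset_iff)
    ultimately show "\<exists>K \<epsilon>. compact K \<and> K \<subseteq> unit_disc \<and> \<epsilon> > 0 \<and>
        (\<forall>g. (\<forall>z\<in>K. norm (hol_fun g z - hol_fun f z) < \<epsilon>) \<longrightarrow> g \<in> comp_op \<phi> -` V \<inter> UNIV)"
      using K(3) by blast
  qed
qed

lemma comp_op_hom:
  "comp_op \<phi> 1 = 1"
  "comp_op \<phi> (f + g) = comp_op \<phi> f + comp_op \<phi> g"
  "comp_op \<phi> (f - g) = comp_op \<phi> f - comp_op \<phi> g"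
  "comp_op \<phi> (f * g) = comp_op \<phi> f * comp_op \<phi> g"
  "comp_op \<phi> (c *\<^sub>C f) = c *\<^sub>C comp_op \<phi> f"
  by (rule hol_disc_eqI; use in_disc in \<open>force simp: hol_fun_ops hol_fun_scaleC hol_fun_comp\<close>)+

lemma comp_op_power: "comp_op \<phi> (f ^ n) = comp_op \<phi> f ^ n"
  by (induction n) (auto simp: comp_op_hom)

lemma comp_op_sum: "comp_op \<phi> (sum f A) = (\<Sum>a\<in>A. comp_op \<phi> (f a))"
proof -
  have "comp_op \<phi> 0 = 0" using comp_op_hom(3)[of 0 0] by simp
  then show ?thesis
    by (induction A rule: infinite_finite_induct) (auto simp: comp_op_hom)
qed

lemma comp_op_linear: "Vector_Spaces.linear scaleC scaleC (comp_op \<phi>)"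
  by unfold_locales (simp_all add: comp_op_hom)

section \<open>Existence and uniqueness of Koenigs' eigenfunction\<close>

abbreviation "\<delta> \<equiv> deriv \<phi> \<alpha>"
abbreviation "u \<equiv> lin \<alpha>"

definition v :: hol_disc where
  "v = hol_of (\<lambda>z. if z = \<alpha> then \<delta> else (\<phi> z - \<alpha>) / (z - \<alpha>))"

lemma hol_fun_v:
  "z \<in> unit_disc \<Longrightarrow> hol_fun v z = (if z = \<alpha> then \<delta> else (\<phi> z - \<alpha>) / (z - \<alpha>))"
  using pole_lemma_open[OF hol open_ball, of \<alpha>, unfolded fp] unfolding v_def
  by (simp add: hol_fun_hol_of)

lemma hol_fun_v_power: "norm (hol_fun (v ^ n) \<alpha>) = norm \<delta> ^ n"
  using \<alpha> by (simp add: hol_fun_power hol_fun_v norm_power)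

lemma comp_op_lin: "comp_op \<phi> u = u * v"
  by (rule hol_disc_eqI) (use in_disc fp in \<open>force simp: hol_fun_comp hol_fun_ops hol_fun_lin hol_fun_v\<close>)

lemma comp_op_lin_power: "comp_op \<phi> (u ^ n * f) = u ^ n * (v ^ n * comp_op \<phi> f)"
  by (simp add: comp_op_hom comp_op_power comp_op_lin power_mult_distrib mult_ac)

text \<open>This is the hypothesis of the weighted lemmas for the weight \<open>v ^ 2\<close> at
  \<mu> = \<delta>. It serves both uniqueness and existence.\<close>

lemma norm_square_less: "norm (\<delta> ^ 2) < norm \<delta>"
  using deriv_pos deriv_less by (simp add: norm_mult power2_eq_square)

lemma eigenvalue_power_inject: "\<delta> ^ j = \<delta> ^ n \<longleftrightarrow> j = n"
  using deriv_pos deriv_less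
  by (metis norm_power power_strict_decreasing_iff order_less_irrefl nat_neq_iff)

text \<open>The difference vanishes to second order at \<alpha>: its value because \<delta> \<noteq>
  1, its derivative by the normalization. Dividing by \<open>u ^ 2\<close> leaves a solution of
  \<delta> g = v^2 (g \<circ> \<phi>), which must be zero.\<close>

lemma koenigs_unique:
  assumes "comp_op \<phi> f = \<delta> *\<^sub>C f" "deriv (hol_fun f) \<alpha> = 1"
    and "comp_op \<phi> g = \<delta> *\<^sub>C g" "deriv (hol_fun g) \<alpha> = 1"
  shows "f = g"
proof -
  define d where "d = f - g"
  have Cd: "comp_op \<phi> d = \<delta> *\<^sub>C d"
    by (simp add: d_def comp_op_hom assms complex_vector.scale_right_diff_distrib)
  have "hol_fun d \<alpha> = \<delta> * hol_fun d \<alpha>"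
    using arg_cong[OF Cd, of "\<lambda>h. hol_fun h \<alpha>"] \<alpha> by (simp add: hol_fun_comp hol_fun_scaleC fp)
  then have d0: "hol_fun d \<alpha> = 0" using deriv_less by force
  have "deriv (hol_fun d) \<alpha> = 0"
    using higher_deriv_hol_diff[OF \<alpha>, of 1 f g] assms by (simp add: d_def)
  then obtain d1 where d1: "d = u * d1" "hol_fun d1 \<alpha> = 0"
    using hol_disc_factor_zero[OF \<alpha> d0] by metis
  then obtain d2 where "d1 = u * d2"
    using hol_disc_factor_zero[OF \<alpha> d1(2)] by metis
  then have d2: "d = u ^ 2 * d2" using d1 by (simp add: power2_eq_square mult_ac)
  have "u ^ 2 * (v ^ 2 * comp_op \<phi> d2) = u ^ 2 * \<delta> *\<^sub>C d2"
    using Cd unfolding d2 comp_op_lin_power hol_disc_mult_scaleC_right .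
  from lin_power_cancel[OF \<alpha> this] have "\<delta> *\<^sub>C d2 = v ^ 2 * comp_op \<phi> d2" ..
  then have "d2 = 0"
    using weighted_eigenfunction_zero[of "v ^ 2" \<delta>] norm_square_less by (simp add: hol_fun_v_power norm_power)
  then show ?thesis using d2 by (simp add: d_def)
qed

text \<open>
  Writing \<open>v = \<delta> + u t\<close>, the ansatz \<open>u (1 + u h)\<close> for the eigenfunction reduces to
  \<open>\<delta> h - v\<^sup>2 (h \<circ> \<phi>) = t\<close>.
\<close>

lemma koenigs_exists:
  obtains h where "comp_op \<phi> (u * (1 + u * h)) = \<delta> *\<^sub>C (u * (1 + u * h))"
proof -
  obtain t where t: "v = \<delta> *\<^sub>C 1 + u * t"
    using hol_disc_factor[OF \<alpha>, of v] hol_fun_v[OF \<alpha>] by metis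
  obtain h where h: "\<delta> *\<^sub>C h - v ^ 2 * comp_op \<phi> h = t"
    using weighted_resolvent_exists[of "v ^ 2" \<delta> t] norm_square_less by (auto simp: hol_fun_v_power norm_power)
  have "comp_op \<phi> (u * (1 + u * h)) = \<delta> *\<^sub>C (u * (1 + u * h))"
  proof (rule hol_disc_eqI)
    fix z :: complex assume z: "z \<in> unit_disc"
    have 1: "hol_fun v z = \<delta> + hol_fun u z * hol_fun t z"
      using arg_cong[OF t, of "\<lambda>h. hol_fun h z"] z by (simp add: hol_fun_ops hol_fun_scaleC)
    have 2: "\<delta> * hol_fun h z - hol_fun v z ^ 2 * hol_fun (comp_op \<phi> h) z = hol_fun t z"
      using arg_cong[OF h, of "\<lambda>h. hol_fun h z"] z
      by (simp add: hol_fun_ops hol_fun_scaleC hol_fun_power)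
    have "hol_fun (comp_op \<phi> (u * (1 + u * h))) z =
        hol_fun u z * hol_fun v z * (1 + hol_fun u z * hol_fun v z * hol_fun (comp_op \<phi> h) z)"
      using z by (simp add: comp_op_hom comp_op_lin hol_fun_ops)
    also have "\<dots> = \<delta> * (hol_fun u z * (1 + hol_fun u z * hol_fun h z))"
      using 1 2 by algebra
    finally show "hol_fun (comp_op \<phi> (u * (1 + u * h))) z = hol_fun (\<delta> *\<^sub>C (u * (1 + u * h))) z"
      using z by (simp add: hol_fun_ops hol_fun_scaleC)
  qed
  then show ?thesis by (rule that)
qed

abbreviation "\<kappa> \<equiv> koenigs \<phi> \<alpha>"

lemma koenigs_factor:
  obtains w where "\<kappa> = u * w" "hol_fun w \<alpha> = 1" "comp_op \<phi> \<kappa> = \<delta> *\<^sub>C \<kappa>"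
proof -
  obtain h where h: "comp_op \<phi> (u * (1 + u * h)) = \<delta> *\<^sub>C (u * (1 + u * h))"
    by (rule koenigs_exists)
  have w: "hol_fun (1 + u * h) \<alpha> = 1" using \<alpha> by (simp add: hol_fun_ops hol_fun_lin)
  then have "deriv (hol_fun (u * (1 + u * h))) \<alpha> = 1" by (simp only: deriv_lin_mult[OF \<alpha>])
  then have "\<kappa> = u * (1 + u * h)"
    unfolding koenigs_def using h koenigs_unique by (intro the_equality) blast+
  then show ?thesis using that h w by metis
qed

text \<open>A name for the quotient \<kappa> / u, so that \<kappa>^n = u^n w^n with w(\<alpha>) =
  1.\<close>

definition w :: hol_disc where
  "w = (SOME w. \<kappa> = u * w \<and> hol_fun w \<alpha> = 1)"

lemma w: "\<kappa> = u * w" "hol_fun w \<alpha> = 1"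
  unfolding w_def using someI_ex[of "\<lambda>w. \<kappa> = u * w \<and> hol_fun w \<alpha> = 1"] koenigs_factor by metis+

lemma comp_op_koenigs_power: "comp_op \<phi> (\<kappa> ^ n) = \<delta> ^ n *\<^sub>C \<kappa> ^ n"
proof (induction n)
  case (Suc n)
  have "comp_op \<phi> \<kappa> = \<delta> *\<^sub>C \<kappa>" using koenigs_factor by blast
  then show ?case
    using Suc by (intro hol_disc_eqI) (simp add: comp_op_hom hol_fun_ops hol_fun_scaleC)
qed (simp add: comp_op_hom scaleC_one)

lemma koenigs_power_nonzero: "\<kappa> ^ n \<noteq> 0"
proof
  assume "\<kappa> ^ n = 0"
  then have "u ^ n * w ^ n = u ^ n * 0" using w(1) by (simp add: power_mult_distrib)
  then have "w ^ n = 0" using lin_power_cancel[OF \<alpha>] by blast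
  then have "hol_fun (w ^ n) \<alpha> = 0" by (simp add: hol_fun_ops)
  then show False using w(2) \<alpha> by (simp add: hol_fun_power)
qed

section \<open>Expansions in powers of \<kappa> with remainder\<close>

text \<open>Only the values of \<open>c\<close> below \<open>N\<close> enter, so expansions of
  different orders can share one \<open>c\<close>.\<close>

definition koenigs_expansion :: "nat \<Rightarrow> (nat \<Rightarrow> complex) \<Rightarrow> hol_disc \<Rightarrow> hol_disc" where
  "koenigs_expansion N c h = (\<Sum>j<N. c j *\<^sub>C \<kappa> ^ j) + u ^ N * h"

text \<open>Since \<kappa>^N = u^N w^N, the last term can be absorbed into the remainder. Read in
  either direction, this lowers or raises the order.\<close>

lemma koenigs_expansion_Suc:
  "koenigs_expansion (Suc N) c h = koenigs_expansion N c (c N *\<^sub>C w ^ N + u * h)"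
proof -
  have "c N *\<^sub>C \<kappa> ^ N = u ^ N * c N *\<^sub>C w ^ N"
    unfolding w(1) power_mult_distrib hol_disc_mult_scaleC_right ..
  then show ?thesis
    by (simp add: koenigs_expansion_def algebra_simps)
qed

text \<open>The next coefficient is h(\<alpha>): as w(\<alpha>) = 1, the function h - h(\<alpha>)
  w^N vanishes at \<alpha> and is divisible by \<open>u\<close>.\<close>

lemma koenigs_expansion_exists: "\<exists>c h. f = koenigs_expansion N c h"
proof (induction N)
  case 0
  then show ?case by (intro exI[of _ "\<lambda>_. 0"] exI[of _ f]) (simp add: koenigs_expansion_def)
next
  case (Suc N)
  then obtain c h where f: "f = koenigs_expansion N c h" by blast
  define c' where "c' = c(N := hol_fun h \<alpha>)"
  have "hol_fun (h - hol_fun h \<alpha> *\<^sub>C w ^ N) \<alpha> = 0"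
    using \<alpha> w(2) by (simp add: hol_fun_ops hol_fun_scaleC hol_fun_power)
  then obtain h' where h': "h - hol_fun h \<alpha> *\<^sub>C w ^ N = u * h'"
    using hol_disc_factor_zero[OF \<alpha>] by blast
  then have h: "h = c' N *\<^sub>C w ^ N + u * h'"
    by (simp add: c'_def diff_eq_eq add.commute)
  have "f = koenigs_expansion N c' h"
    unfolding f by (simp add: koenigs_expansion_def c'_def)
  also have "\<dots> = koenigs_expansion (Suc N) c' h'"
    unfolding koenigs_expansion_Suc h[symmetric] ..
  finally show ?case by blast
qed

lemma koenigs_expansion_add:
  "koenigs_expansion N c h + koenigs_expansion N c' h' = koenigs_expansion N (\<lambda>j. c j + c' j) (h + h')"
  by (simp add: koenigs_expansion_def scaleC_add_left sum.distrib algebra_simps)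

lemma koenigs_expansion_diff:
  "koenigs_expansion N c h - koenigs_expansion N c' h' = koenigs_expansion N (\<lambda>j. c j - c' j) (h - h')"
  by (simp add: diff_eq_eq koenigs_expansion_add)

lemma koenigs_expansion_scaleC:
  "a *\<^sub>C koenigs_expansion N c h = koenigs_expansion N (\<lambda>j. a * c j) (a *\<^sub>C h)"
  by (simp add: koenigs_expansion_def scaleC_add_right complex_vector.scale_sum_right scaleC_scaleC
      hol_disc_mult_scaleC_right)

lemma comp_op_koenigs_expansion:
  "comp_op \<phi> (koenigs_expansion N c h) =
     koenigs_expansion N (\<lambda>j. \<delta> ^ j * c j) (v ^ N * comp_op \<phi> h)"
  by (simp add: koenigs_expansion_def comp_op_hom(2,5) comp_op_sum comp_op_lin_power
      comp_op_koenigs_power scaleC_scaleC mult.commute[of "_ :: complex"])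

text \<open>In these coordinates \<mu> - C splits into a diagonal action on the coefficients and the
  weighted operator with weight \<open>v ^ N\<close> on the remainder, which can be inverted
  separately.\<close>

lemma resolvent_koenigs_expansion:
  "\<mu> *\<^sub>C koenigs_expansion N c h - comp_op \<phi> (koenigs_expansion N c h) =
     koenigs_expansion N (\<lambda>j. (\<mu> - \<delta> ^ j) * c j) (\<mu> *\<^sub>C h - v ^ N * comp_op \<phi> h)"
  by (simp add: eq_diff_eq[symmetric] diff_eq_eq comp_op_koenigs_expansion koenigs_expansion_scaleC
      koenigs_expansion_add left_diff_distrib)

text \<open>By strong induction the earlier projections strip off the first n terms, leaving u^n
  (c_n w^n + u r). Its n-th Taylor coefficient at \<alpha> is c_n, because w(\<alpha>) = 1 and
  u(\<alpha>) = 0.\<close>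

lemma koenigs_proj_expansion:
  "n < N \<Longrightarrow> koenigs_proj \<alpha> \<kappa> n (koenigs_expansion N c h) = c n *\<^sub>C \<kappa> ^ n"
proof (induction n rule: less_induct)
  case (less n)
  let ?f = "koenigs_expansion N c h"
  \<comment> \<open>Downward induction from \<open>N\<close> lowers the order, changing the
    remainder but not \<open>c\<close>.\<close>
  have "\<exists>r. ?f = koenigs_expansion m c r" if "m \<le> N" for m
    using that
  proof (induction m rule: inc_induct)
    case (step m)
    then show ?case unfolding koenigs_expansion_Suc by blast
  qed blast
  then obtain r where "?f = koenigs_expansion (Suc n) c r" using less.prems by (meson Suc_leI)
  then have r: "?f = koenigs_expansion n c (c n *\<^sub>C w ^ n + u * r)"
    using koenigs_expansion_Suc by metis
  have sum: "(\<Sum>k<n. koenigs_proj \<alpha> \<kappa> k ?f) = (\<Sum>k<n. c k *\<^sub>C \<kappa> ^ k)"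
    using less by (intro sum.cong) auto
  have "?f - (\<Sum>k<n. koenigs_proj \<alpha> \<kappa> k ?f) = u ^ n * (c n *\<^sub>C w ^ n + u * r)"
    unfolding sum by (subst r) (simp add: koenigs_expansion_def)
  then have "koenigs_proj \<alpha> \<kappa> n ?f =
      ((deriv ^^ n) (hol_fun (u ^ n * (c n *\<^sub>C w ^ n + u * r))) \<alpha> / fact n) *\<^sub>C \<kappa> ^ n"
    by (subst koenigs_proj_eq) simp
  also have "\<dots> = c n *\<^sub>C \<kappa> ^ n"
    unfolding higher_deriv_lin_power_mult[OF \<alpha>] using \<alpha> w(2)
    by (simp add: hol_fun_ops hol_fun_scaleC hol_fun_power hol_fun_lin)
  finally show ?case .
qed

text \<open>The projections recover the coefficients, so comparison with the zero expansion kills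
  them; cancelling \<open>u ^ N\<close> then kills the remainder.\<close>

lemma koenigs_expansion_eq_0:
  assumes "koenigs_expansion N c h = 0"
  shows "\<And>j. j < N \<Longrightarrow> c j = 0" and "h = 0"
proof -
  have 0: "koenigs_expansion N (\<lambda>_. 0) 0 = 0" by (simp add: koenigs_expansion_def)
  show c: "c j = 0" if "j < N" for j
  proof -
    have "c j *\<^sub>C \<kappa> ^ j = 0 *\<^sub>C \<kappa> ^ j"
      using koenigs_proj_expansion[OF that, of c h]
        koenigs_proj_expansion[OF that, of "\<lambda>_. 0" 0] unfolding 0 assms by simp
    then show ?thesis using koenigs_power_nonzero by simp
  qed
  have "u ^ N * h = u ^ N * 0" using assms c by (simp add: koenigs_expansion_def)
  then show "h = 0" using lin_power_cancel[OF \<alpha>] by blast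
qed

text \<open>
  The whole space if \<open>\<mu>\<close> is not a power of \<open>\<delta>\<close>, and the kernel of \<open>P\<^sub>n\<close> if \<open>\<mu> = \<delta>\<^sup>n\<close> and \<open>N = n + 1\<close>.
\<close>

definition off_eigenspace :: "nat \<Rightarrow> complex \<Rightarrow> hol_disc set" where
  "off_eigenspace N \<mu> = {koenigs_expansion N c h | c h. \<forall>j<N. \<delta> ^ j = \<mu> \<longrightarrow> c j = 0}"

lemma off_eigenspaceI:
  "(\<And>j. j < N \<Longrightarrow> \<delta> ^ j = \<mu> \<Longrightarrow> c j = 0) \<Longrightarrow> koenigs_expansion N c h \<in> off_eigenspace N \<mu>"
  unfolding off_eigenspace_def by blast

lemma off_eigenspaceE:
  assumes "f \<in> off_eigenspace N \<mu>"
  obtains c h where "f = koenigs_expansion N c h" "\<And>j. j < N \<Longrightarrow> \<delta> ^ j = \<mu> \<Longrightarrow> c j = 0"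
  using assms unfolding off_eigenspace_def by blast

section \<open>Resolvents and the spectrum\<close>

text \<open>The factor \<mu> - \<delta>^j is nonzero wherever the j-th coefficient may be nonzero,
  and the weighted operator on the remainder is bijective because |v(\<alpha>)|^N < |\<mu>|.\<close>

lemma bij_betw_off_eigenspace:
  assumes \<mu>: "norm \<delta> ^ N < norm \<mu>"
  shows "bij_betw (\<lambda>y. \<mu> *\<^sub>C y - comp_op \<phi> y) (off_eigenspace N \<mu>) (off_eigenspace N \<mu>)"
    (is "bij_betw ?S ?V ?V")
  unfolding bij_betw_def
proof
  have \<mu>': "norm (hol_fun (v ^ N) \<alpha>) < norm \<mu>" using \<mu> by (simp add: hol_fun_v_power)
  show "inj_on ?S ?V"
  proof (rule inj_onI)
    fix x y assume xV: "x \<in> ?V" and yV: "y \<in> ?V" and eq: "?S x = ?S y"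
    obtain c h where x: "x = koenigs_expansion N c h" "\<And>j. j < N \<Longrightarrow> \<delta> ^ j = \<mu> \<Longrightarrow> c j = 0"
      using xV by (rule off_eigenspaceE) blast
    obtain c' h' where y: "y = koenigs_expansion N c' h'" "\<And>j. j < N \<Longrightarrow> \<delta> ^ j = \<mu> \<Longrightarrow> c' j = 0"
      using yV by (rule off_eigenspaceE) blast
    define b g where "b = (\<lambda>j. c j - c' j)" and "g = h - h'"
    have xy: "x - y = koenigs_expansion N b g"
      unfolding x(1) y(1) b_def g_def by (rule koenigs_expansion_diff)
    have "?S (x - y) = 0"
      using eq by (simp add: comp_op_hom complex_vector.scale_right_diff_distrib algebra_simps)
    then have 0: "koenigs_expansion N (\<lambda>j. (\<mu> - \<delta> ^ j) * b j) (\<mu> *\<^sub>C g - v ^ N * comp_op \<phi> g) = 0"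
      unfolding xy resolvent_koenigs_expansion .
    have "b j = 0" if "j < N" for j
      using koenigs_expansion_eq_0(1)[OF 0 that] x(2)[OF that] y(2)[OF that] by (auto simp: b_def)
    moreover have "g = 0"
      using koenigs_expansion_eq_0(2)[OF 0] by (intro weighted_eigenfunction_zero[OF \<mu>']) simp
    ultimately have "x - y = 0" unfolding xy by (simp add: koenigs_expansion_def)
    then show "x = y" by simp
  qed
  show "?S ` ?V = ?V"
  proof (intro equalityI subsetI)
    fix y assume "y \<in> ?S ` ?V"
    then obtain x where x: "x \<in> ?V" "y = ?S x" by blast
    from x(1) obtain c h where c: "x = koenigs_expansion N c h" "\<And>j. j < N \<Longrightarrow> \<delta> ^ j = \<mu> \<Longrightarrow> c j = 0"
      by (rule off_eigenspaceE) blast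
    show "y \<in> ?V"
      unfolding x(2) c(1) resolvent_koenigs_expansion by (rule off_eigenspaceI) (simp add: c(2))
  next
    fix y assume "y \<in> ?V"
    then obtain c h where y: "y = koenigs_expansion N c h" "\<And>j. j < N \<Longrightarrow> \<delta> ^ j = \<mu> \<Longrightarrow> c j = 0"
      by (rule off_eigenspaceE) blast
    obtain g where g: "\<mu> *\<^sub>C g - v ^ N * comp_op \<phi> g = h"
      using weighted_resolvent_exists[OF \<mu>'] .
    \<comment> \<open>Where \<delta>^j = \<mu> the quotient is 0 by the convention for division by
      zero, and \<open>c j\<close> is 0 there as well.\<close>
    let ?x = "koenigs_expansion N (\<lambda>j. c j / (\<mu> - \<delta> ^ j)) g"
    have "(\<mu> - \<delta> ^ j) * (c j / (\<mu> - \<delta> ^ j)) = c j" if "j < N" for j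
      using y(2)[OF that] by (cases "\<delta> ^ j = \<mu>") auto
    then have "y = ?S ?x"
      unfolding resolvent_koenigs_expansion g y(1) by (simp add: koenigs_expansion_def)
    moreover have "?x \<in> ?V" by (rule off_eigenspaceI) (simp add: y(2))
    ultimately show "y \<in> ?S ` ?V" by blast
  qed
qed

text \<open>For \<mu> nonzero and not a power of \<delta>, the condition defining
  \<open>off_eigenspace N \<mu>\<close> is vacuous. A large \<open>N\<close> then makes \<mu> - C
  bijective on the whole space.\<close>

lemma spectrum_subset: "spectrum (comp_op \<phi>) \<subseteq> insert 0 (range (\<lambda>n. \<delta> ^ n))"
proof
  fix \<mu> assume \<mu>: "\<mu> \<in> spectrum (comp_op \<phi>)"
  show "\<mu> \<in> insert 0 (range (\<lambda>n. \<delta> ^ n))"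
  proof (rule ccontr)
    assume n: "\<mu> \<notin> insert 0 (range (\<lambda>n. \<delta> ^ n))"
    then obtain N where N: "norm \<delta> ^ N < norm \<mu>"
      using real_arch_pow_inv[of "norm \<mu>" "norm \<delta>"] deriv_less by auto
    have "f \<in> off_eigenspace N \<mu>" for f
    proof -
      obtain c h where f: "f = koenigs_expansion N c h" using koenigs_expansion_exists by blast
      show ?thesis unfolding f by (rule off_eigenspaceI) (use n in blast)
    qed
    then have "off_eigenspace N \<mu> = UNIV" by blast
    then show False
      using bij_betw_off_eigenspace[OF N] \<mu> by (simp add: spectrum_on_def)
  qed
qed

section \<open>Linearity, kernels and continuity of the projections\<close>

text \<open>Additivity is read off the n-th coefficient of expansions of order n + 1, without
  unfolding the recursion.\<close>

lemma koenigs_proj_add: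
  "koenigs_proj \<alpha> \<kappa> n (f + g) = koenigs_proj \<alpha> \<kappa> n f + koenigs_proj \<alpha> \<kappa> n g"
proof -
  obtain c h c' h' where "f = koenigs_expansion (Suc n) c h" "g = koenigs_expansion (Suc n) c' h'"
    using koenigs_expansion_exists by metis
  then show ?thesis by (simp add: koenigs_expansion_add koenigs_proj_expansion scaleC_add_left)
qed

lemma koenigs_proj_scaleC:
  "koenigs_proj \<alpha> \<kappa> n (a *\<^sub>C f) = a *\<^sub>C koenigs_proj \<alpha> \<kappa> n f"
proof -
  obtain c h where "f = koenigs_expansion (Suc n) c h"
    using koenigs_expansion_exists by metis
  then show ?thesis by (simp add: koenigs_expansion_scaleC koenigs_proj_expansion scaleC_scaleC)
qed

lemma koenigs_proj_power: "koenigs_proj \<alpha> \<kappa> n (\<kappa> ^ n) = \<kappa> ^ n"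
proof -
  have "\<kappa> ^ n = koenigs_expansion (Suc n) (\<lambda>j. if j = n then 1 else 0) 0"
    by (simp add: koenigs_expansion_def scaleC_one)
  then show ?thesis
    using koenigs_proj_expansion[of n "Suc n" "\<lambda>j. if j = n then 1 else 0" 0]
    by (simp add: scaleC_one)
qed

lemma kernel_koenigs_proj: "{f. koenigs_proj \<alpha> \<kappa> n f = 0} = off_eigenspace (Suc n) (\<delta> ^ n)"
proof (intro equalityI subsetI)
  fix f assume f: "f \<in> {f. koenigs_proj \<alpha> \<kappa> n f = 0}"
  obtain c h where c: "f = koenigs_expansion (Suc n) c h" using koenigs_expansion_exists by metis
  then have "c n = 0"
    using f koenigs_proj_expansion[of n "Suc n" c h] koenigs_power_nonzero by simp
  then show "f \<in> off_eigenspace (Suc n) (\<delta> ^ n)"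
    unfolding off_eigenspace_def eigenvalue_power_inject using c by blast
qed (auto simp: off_eigenspace_def koenigs_proj_expansion)

text \<open>This continuity makes range and kernel of the projection closed. By strong induction,
  the n-th coefficient is a combination of the n-th derivative at \<alpha> and the earlier
  coefficients.\<close>

lemma koenigs_coeff_exists:
  obtains a where "continuous_on UNIV a" "\<And>f. koenigs_proj \<alpha> \<kappa> n f = a f *\<^sub>C \<kappa> ^ n"
proof -
  define a where
    "a n f = (deriv ^^ n) (hol_fun (f - (\<Sum>k<n. koenigs_proj \<alpha> \<kappa> k f))) \<alpha> / fact n" for n f
  have a: "koenigs_proj \<alpha> \<kappa> n f = a n f *\<^sub>C \<kappa> ^ n" for n f
    unfolding a_def by (rule koenigs_proj_eq)
  have "continuous_on UNIV (a n)" for n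
  proof (induction n rule: less_induct)
    case (less n)
    have "a n = (\<lambda>f. ((deriv ^^ n) (hol_fun f) \<alpha> -
        (\<Sum>k<n. a k f * (deriv ^^ n) (hol_fun (\<kappa> ^ k)) \<alpha>)) / fact n)"
      unfolding a_def[of n] a higher_deriv_hol_diff[OF \<alpha>] higher_deriv_hol_sum[OF \<alpha>]
        higher_deriv_hol_scaleC[OF \<alpha>] ..
    then show ?case
      using less by (auto intro!: continuous_intros higher_deriv_hol_continuous[OF \<alpha>])
  qed
  then show ?thesis using a that by blast
qed

section \<open>Riesz decompositions and isolated eigenvalues\<close>

text \<open>The two summands are the range and the kernel of the projection. On the kernel,
  bijectivity comes from expansions of order n + 1, since |\<delta>|^(n+1) < |\<delta>|^n.\<close>

lemma riesz_decomposition_koenigs: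
  "riesz_decomposition (comp_op \<phi>) (\<delta> ^ n) (range (\<lambda>c. c *\<^sub>C \<kappa> ^ n)) {f. koenigs_proj \<alpha> \<kappa> n f = 0}"
    (is "riesz_decomposition ?C _ ?Y1 ?Y2")
proof -
  obtain a where a: "continuous_on UNIV a" "\<And>f. koenigs_proj \<alpha> \<kappa> n f = a f *\<^sub>C \<kappa> ^ n"
    using koenigs_coeff_exists[of n] by blast
  have proj1: "koenigs_proj \<alpha> \<kappa> n (c *\<^sub>C \<kappa> ^ n) = c *\<^sub>C \<kappa> ^ n" for c
    by (simp add: koenigs_proj_scaleC koenigs_proj_power)
  have span: "complex_vector.span {\<kappa> ^ n} = ?Y1"
    by (rule complex_vector.span_singleton)
  \<comment> \<open>Written pointwise, \<open>f = a f *\<^sub>C \<kappa> ^ n\<close> equates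
    continuous functionals of \<open>f\<close>, so it is a closed condition.\<close>
  have "?Y1 = {f. \<forall>z. hol_fun f z = a f * hol_fun (\<kappa> ^ n) z}"
  proof (intro equalityI subsetI)
    fix f assume "f \<in> ?Y1"
    then have *: "f = a f *\<^sub>C \<kappa> ^ n" using proj1 a(2) by force
    have "hol_fun f z = a f * hol_fun (\<kappa> ^ n) z" for z
      using arg_cong[OF *, of "\<lambda>g. hol_fun g z"] unfolding hol_fun_scaleC .
    then show "f \<in> {f. \<forall>z. hol_fun f z = a f * hol_fun (\<kappa> ^ n) z}" by blast
  next
    fix f assume "f \<in> {f. \<forall>z. hol_fun f z = a f * hol_fun (\<kappa> ^ n) z}"
    then have "f = a f *\<^sub>C \<kappa> ^ n" by (intro hol_disc_eqI) (simp add: hol_fun_scaleC)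
    then show "f \<in> ?Y1" by blast
  qed
  then have closed1: "closed ?Y1"
    by (auto intro!: closed_Collect_all closed_Collect_eq continuous_intros hol_fun_continuous a)
  have "?Y2 = {f. a f = 0}"
    using a(2) koenigs_power_nonzero by simp
  then have closed2: "closed ?Y2"
    by (auto intro!: closed_Collect_eq continuous_intros a)
  have bij: "bij_betw (\<lambda>y. \<delta> ^ n *\<^sub>C y - ?C y) ?Y2 ?Y2"
    unfolding kernel_koenigs_proj
    using deriv_pos deriv_less
    by (intro bij_betw_off_eigenspace) (simp add: norm_power)
  have sub2: "complex_vector.subspace ?Y2"
    using koenigs_proj_scaleC[of n 0 0]
    by (auto simp: complex_vector.subspace_def koenigs_proj_add koenigs_proj_scaleC)
  have inv2: "?C ` ?Y2 \<subseteq> ?Y2"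
  proof
    fix y assume "y \<in> ?C ` ?Y2"
    then obtain c h where "y = ?C (koenigs_expansion (Suc n) c h)" "c n = 0"
      unfolding kernel_koenigs_proj by (auto elim: off_eigenspaceE)
    then show "y \<in> ?Y2"
      by (simp add: comp_op_koenigs_expansion koenigs_proj_expansion)
  qed
  have inv1: "?C ` ?Y1 \<subseteq> ?Y1"
    by (auto simp: comp_op_hom comp_op_koenigs_power scaleC_scaleC)
  have int: "?Y1 \<inter> ?Y2 = {0}"
    using proj1 sub2 complex_vector.subspace_0 by (auto intro: range_eqI[of _ _ 0])
  have sum: "\<exists>y1\<in>?Y1. \<exists>y2\<in>?Y2. y = y1 + y2" for y
  proof (intro bexI)
    have "koenigs_proj \<alpha> \<kappa> n (y - a y *\<^sub>C \<kappa> ^ n) + a y *\<^sub>C \<kappa> ^ n = a y *\<^sub>C \<kappa> ^ n"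
      using koenigs_proj_add[of n "y - a y *\<^sub>C \<kappa> ^ n" "a y *\<^sub>C \<kappa> ^ n"] proj1 by (simp add: a(2)[of y])
    then show "y - a y *\<^sub>C \<kappa> ^ n \<in> ?Y2" by simp
  qed auto
  have spec: "spectrum_on ?Y1 ?C = {\<delta> ^ n}"
  proof -
    have res: "\<mu> *\<^sub>C c *\<^sub>C \<kappa> ^ n - ?C (c *\<^sub>C \<kappa> ^ n) = ((\<mu> - \<delta> ^ n) * c) *\<^sub>C \<kappa> ^ n" for \<mu> c
      by (simp add: comp_op_hom(5) comp_op_koenigs_power scaleC_scaleC left_diff_distrib
          complex_vector.scale_left_diff_distrib mult.commute[of c])
    have "\<not> bij_betw (\<lambda>y. \<delta> ^ n *\<^sub>C y - ?C y) ?Y1 ?Y1"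
    proof
      assume "bij_betw (\<lambda>y. \<delta> ^ n *\<^sub>C y - ?C y) ?Y1 ?Y1"
      then have "inj_on (\<lambda>y. \<delta> ^ n *\<^sub>C y - ?C y) ?Y1" by (rule bij_betw_imp_inj_on)
      \<comment> \<open>Both vectors are sent to 0.\<close>
      then have "1 *\<^sub>C \<kappa> ^ n = 0 *\<^sub>C \<kappa> ^ n"
        by (rule inj_onD) (simp only: res diff_self mult_zero_left, (rule rangeI)+)
      then show False using koenigs_power_nonzero by (simp add: scaleC_one)
    qed
    moreover have "bij_betw (\<lambda>y. \<mu> *\<^sub>C y - ?C y) ?Y1 ?Y1" if "\<mu> \<noteq> \<delta> ^ n" for \<mu>
    proof (rule bij_betwI[where g = "\<lambda>y. inverse (\<mu> - \<delta> ^ n) *\<^sub>C y"])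
      show "(\<lambda>y. \<mu> *\<^sub>C y - ?C y) \<in> ?Y1 \<rightarrow> ?Y1"
        by (rule Pi_I, elim rangeE, simp only: res, rule rangeI)
      show "(*\<^sub>C) (inverse (\<mu> - \<delta> ^ n)) \<in> ?Y1 \<rightarrow> ?Y1"
        by (rule Pi_I, elim rangeE, simp only: scaleC_scaleC, rule rangeI)
    next
      fix y assume "y \<in> ?Y1"
      then obtain c where y: "y = c *\<^sub>C \<kappa> ^ n" by blast
      show "inverse (\<mu> - \<delta> ^ n) *\<^sub>C (\<mu> *\<^sub>C y - ?C y) = y"
        unfolding y res using that by (simp add: scaleC_scaleC)
      have "inverse (\<mu> - \<delta> ^ n) *\<^sub>C y = (inverse (\<mu> - \<delta> ^ n) * c) *\<^sub>C \<kappa> ^ n"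
        by (simp add: y scaleC_scaleC)
      then show "\<mu> *\<^sub>C inverse (\<mu> - \<delta> ^ n) *\<^sub>C y - ?C (inverse (\<mu> - \<delta> ^ n) *\<^sub>C y) = y"
        using that by (simp only: res) (simp add: y)
    qed
    ultimately show ?thesis by (auto simp: spectrum_on_def)
  qed
  show ?thesis
    unfolding riesz_decomposition_def
    using complex_vector.subspace_span[of "{\<kappa> ^ n}"] unfolding span
    by (intro conjI allI exI[of _ "{\<kappa> ^ n}"] closed1 closed2 bij sub2 inv1 inv2 int sum spec span)
      simp_all
qed

lemma isolated_eigenvalue: "\<delta> ^ n isolated_in spectrum (comp_op \<phi>)"
proof -
  have "\<not> inj (\<lambda>y. \<delta> ^ n *\<^sub>C y - comp_op \<phi> y)"
  proof
    assume "inj (\<lambda>y. \<delta> ^ n *\<^sub>C y - comp_op \<phi> y)"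
    then have "\<kappa> ^ n = 0"
      by (rule injD) (use comp_op_hom(5)[of 0 0] in \<open>simp add: comp_op_koenigs_power\<close>)
    then show False using koenigs_power_nonzero by blast
  qed
  then have in_spec: "\<delta> ^ n \<in> spectrum (comp_op \<phi>)" by (auto simp: spectrum_on_def bij_def)
  \<comment> \<open>The modulus bound excludes 0 and the powers beyond n; the finitely many powers
    before n are removed by hand. What remains is an open set meeting the spectrum only in
    \<delta>^n.\<close>
  define T where "T = {z. norm \<delta> ^ Suc n < norm z} - (\<lambda>j. \<delta> ^ j) ` {..<n}"
  have "open T"
    unfolding T_def by (intro open_Diff open_Collect_less finite_imp_closed continuous_intros) auto
  have less: "norm \<delta> ^ Suc n < norm \<delta> ^ j \<longleftrightarrow> j < Suc n" for j
    using deriv_pos deriv_less by (simp add: power_strict_decreasing_iff del: power_Suc)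
  have "\<mu> = \<delta> ^ n" if \<mu>: "\<mu> \<in> T" "\<mu> \<in> spectrum (comp_op \<phi>)" for \<mu>
  proof -
    have "0 \<le> norm \<delta> ^ Suc n" "norm \<delta> ^ Suc n < norm \<mu>" using \<mu> by (auto simp: T_def)
    then have "0 < norm \<mu>" by (rule order_le_less_trans)
    then have "\<mu> \<noteq> 0" by simp
    then obtain j where j: "\<mu> = \<delta> ^ j" using spectrum_subset \<mu>(2) by blast
    then have "j < Suc n" "j \<notin> {..<n}" using \<mu> less[of j] by (auto simp: T_def norm_power)
    then show ?thesis using j by (simp add: less_Suc_eq)
  qed
  moreover have "\<delta> ^ n \<in> T"
    using less[of n] by (auto simp: T_def norm_power eigenvalue_power_inject simp del: power_Suc)
  ultimately show ?thesis
    using in_spec \<open>open T\<close> unfolding isolated_in_def by blast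
qed

lemma spectral_projection_koenigs:
  "is_spectral_projection (comp_op \<phi>) (\<delta> ^ n) (koenigs_proj \<alpha> \<kappa> n)"
proof -
  have "koenigs_proj \<alpha> \<kappa> n (y1 + y2) = y1"
    if "y1 \<in> range (\<lambda>c. c *\<^sub>C \<kappa> ^ n)" "y2 \<in> {f. koenigs_proj \<alpha> \<kappa> n f = 0}" for y1 y2
    using that by (auto simp: koenigs_proj_add koenigs_proj_scaleC koenigs_proj_power)
  then show ?thesis
    unfolding is_spectral_projection_def riesz_point_def
    using riesz_decomposition_koenigs isolated_eigenvalue by blast
qed

text \<open>All nonzero spectral points are Riesz points, so the essential spectrum is empty or {0};
  in both cases the supremum in \<open>ennreal\<close> is 0.\<close>

lemma riesz_operator_comp_op: "riesz_operator (comp_op \<phi>)"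
proof -
  have "essential_spectrum (comp_op \<phi>) \<subseteq> {0}"
    using spectrum_subset spectral_projection_koenigs
    unfolding essential_spectrum_def is_spectral_projection_def by blast
  then have "essential_spectral_radius (comp_op \<phi>) \<le> 0"
    unfolding essential_spectral_radius_def by (intro SUP_least) auto
  then show ?thesis
    unfolding riesz_operator_def using comp_op_linear comp_op_continuous by simp
qed

end

theorem theorem4p6:
  fixes \<phi> :: "complex \<Rightarrow> complex" and \<alpha> :: complex
  assumes "\<phi> holomorphic_on unit_disc"
    and "\<phi> ` unit_disc \<subseteq> unit_disc"
    and "\<phi> \<notin> disc_automorphisms"
    and "\<alpha> \<in> unit_disc"
    and "\<phi> \<alpha> = \<alpha>"
    and "0 < norm (deriv \<phi> \<alpha>)"
    and "norm (deriv \<phi> \<alpha>) < 1"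
  shows "riesz_operator (comp_op \<phi>) \<and>
    (\<forall>n. is_spectral_projection (comp_op \<phi>) (deriv \<phi> \<alpha> ^ n) (koenigs_proj \<alpha> (koenigs \<phi> \<alpha>) n))"
proof -
  interpret attracting_fixed_point \<phi> \<alpha>
    by unfold_locales (fact assms)+
  show ?thesis
    using riesz_operator_comp_op spectral_projection_koenigs by blast
qed

end
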